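(* Let $\mathcal{H}_C$ be finite-dimensional, $M$ a fixed self-adjoint operator on $\mathcal{H}_C$, $Q\subset\mathbb{Z}^d$ finite, and $A'_{\vec q}$ ($\vec q\in Q$) operators on $\mathcal{H}_C$, independent of $a$, such that $\sum_{\vec q\in Q}A'_{\vec q}S_{\vec q}$ is unitary and $\sum_{\vec q\in Q}A'_{\vec q}=\mathbb{I}$. Consider the massive quantum walk with evolution operator $$U=W\sum_{\vec q\in Q}A'_{\vec q}S_{\vec q},\qquad W=e^{-iMa}.$$ Then its continuum Hamiltonian is $$H=\sum_{\vec q\in Q}A'_{\vec q}\,(\vec q\cdot\vec P)+M.$$ That is, for every fixed $t>0$, with $N=t/a$ an integer, and every momentum cutoff $\Lambda=\Lambda(a)$ with $\Lambda\to\infty$ and $\Lambda^2a\to0$ as $a\to0$, one has $\|e^{-iHt}-U^{N}\|_{\Lambda}\to0$ as $a\to0$.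
   Context: A quantum walk on $\mathbb{Z}^d$ has Hilbert space $\mathcal{H}_C\otimes\mathcal{H}_P$, where $\mathcal{H}_P$ has orthonormal basis $|\vec n\rangle$, $\vec n\in\mathbb{Z}^d$; $S_{\vec q}|\vec n\rangle=|\vec n+\vec q\rangle$. The lattice spacing and the duration of one timestep are both $a>0$. To take the continuum limit, the walk is embedded in the continuum space $\mathcal{H}_C\otimes L^2(\mathbb{R}^d)$: the shift $S_{\vec q}$ becomes $e^{-i\vec q\cdot\vec P a}$, where $\vec P=(P_1,\dots,P_d)$, $P_b=-i\partial_{x_b}$, is the continuum momentum operator. $\|\cdot\|_\Lambda$ is the operator norm restricted to the subspace of states whose momentum components all satisfy $|p_b|\le\Lambda$. *)

theory Defs
  imports "HOL-Analysis.Analysis"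
begin

(* The coin space is complex ^ 'c with its Euclidean norm, the space dimension is CARD('d).
   Elements of the continuum space are represented by functions; two functions that are equal
   almost everywhere represent the same state. *)

type_synonym ('d, 'c) lattice_state = "int ^ 'd \<Rightarrow> complex ^ 'c"
type_synonym ('d, 'c) state = "real ^ 'd \<Rightarrow> complex ^ 'c"

definition coin_inner :: "complex ^ 'c \<Rightarrow> complex ^ 'c \<Rightarrow> complex" where
  "coin_inner u v = (\<Sum>i\<in>UNIV. cnj (u $ i) * v $ i)"

definition self_adjoint :: "complex ^ 'c ^ 'c \<Rightarrow> bool" where
  "self_adjoint M \<longleftrightarrow> (\<forall>u v. coin_inner (M *v u) v = coin_inner u (M *v v))"

definition matrix_exp :: "complex ^ 'c ^ 'c \<Rightarrow> complex ^ 'c ^ 'c" where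
  "matrix_exp A = (\<Sum>k. (1 / fact k) *\<^sub>R (((**) A ^^ k) (mat 1)))"


definition lattice_l2 :: "('d::finite, 'c::finite) lattice_state set" where
  "lattice_l2 = {\<psi>. (\<lambda>n. (norm (\<psi> n))\<^sup>2) summable_on UNIV}"

definition lattice_inner ::
    "('d::finite, 'c::finite) lattice_state \<Rightarrow> ('d, 'c) lattice_state \<Rightarrow> complex" where
  "lattice_inner \<psi> \<phi> = (\<Sum>\<^sub>\<infinity>n. coin_inner (\<psi> n) (\<phi> n))"

definition lattice_unitary ::
    "(('d::finite, 'c::finite) lattice_state \<Rightarrow> ('d, 'c) lattice_state) \<Rightarrow> bool" where
  "lattice_unitary T \<longleftrightarrow>
     T ` lattice_l2 = lattice_l2 \<and>
     (\<forall>\<psi>\<in>lattice_l2. \<forall>\<phi>\<in>lattice_l2. lattice_inner (T \<psi>) (T \<phi>) = lattice_inner \<psi> \<phi>)"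

(* The shift by q maps the basis vector at n to the one at n + q. *)
definition lattice_shift ::
    "int ^ 'd \<Rightarrow> ('d::finite, 'c::finite) lattice_state \<Rightarrow> ('d, 'c) lattice_state" where
  "lattice_shift q \<psi> = (\<lambda>n. \<psi> (n - q))"

definition lattice_walk ::
    "(int ^ 'd) set \<Rightarrow> (int ^ 'd \<Rightarrow> complex ^ 'c ^ 'c) \<Rightarrow>
     ('d::finite, 'c::finite) lattice_state \<Rightarrow> ('d, 'c) lattice_state" where
  "lattice_walk Q A \<psi> = (\<lambda>n. \<Sum>q\<in>Q. A q *v lattice_shift q \<psi> n)"


definition L2 :: "('d::finite, 'c::finite) state set" where
  "L2 = {\<psi>. \<psi> \<in> borel_measurable lborel \<and> integrable lborel (\<lambda>x. (norm (\<psi> x))\<^sup>2)}"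

(* Infinite outside L2, so that a bound on the norm includes membership in L2. *)
definition L2_norm :: "('d::finite, 'c::finite) state \<Rightarrow> ennreal" where
  "L2_norm \<psi> = (if \<psi> \<in> L2 then ennreal (sqrt (LINT x|lborel. (norm (\<psi> x))\<^sup>2)) else \<infinity>)"

(* The partial derivative of a state, as the L2-limit of difference quotients. The domain on
   which the limit exists is that of the weak derivative, so that -i times this operator is the
   self-adjoint momentum operator. The result is unspecified outside that domain. *)
definition L2_partial :: "'d \<Rightarrow> ('d::finite, 'c::finite) state \<Rightarrow> ('d, 'c) state" where
  "L2_partial b \<psi> = (SOME \<eta>. \<eta> \<in> L2 \<and>
     ((\<lambda>h. L2_norm (\<lambda>x. (1 / h) *\<^sub>R (\<psi> (x + h *\<^sub>R axis b 1) - \<psi> x) - \<eta> x)) \<longlongrightarrow> 0) (at 0))"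

definition momentum :: "'d \<Rightarrow> ('d::finite, 'c::finite) state \<Rightarrow> ('d, 'c) state" where
  "momentum b \<psi> = (\<lambda>x. (- \<i>) *s L2_partial b \<psi> x)"

definition dot_momentum :: "int ^ 'd \<Rightarrow> ('d::finite, 'c::finite) state \<Rightarrow> ('d, 'c) state" where
  "dot_momentum q \<psi> = (\<lambda>x. \<Sum>b\<in>UNIV. of_int (q $ b) *s momentum b \<psi> x)"

(* The exponential exp (c T) applied to a state, as its power series converging in L2. For the
   unbounded operators T used below this is specified on vectors for which the series converges.
   These include every state of bounded momentum: T maps the subspace momentum_cutoff L below to
   itself and is bounded there. *)
definition op_exp ::
    "complex \<Rightarrow> (('d::finite, 'c::finite) state \<Rightarrow> ('d, 'c) state) \<Rightarrow>
     ('d, 'c) state \<Rightarrow> ('d, 'c) state" where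
  "op_exp c T \<psi> = (SOME \<eta>. \<eta> \<in> L2 \<and>
     (\<lambda>K. L2_norm (\<lambda>x. \<eta> x - (\<Sum>k<K. (c ^ k / fact k) *s (T ^^ k) \<psi> x))) \<longlonglongrightarrow> 0)"

(* The states all of whose momentum components are at most L in absolute value: superpositions
   of plane waves exp (i p . x) with p in the cube. The amplitude is square integrable with
   bounded support, hence integrable. *)
definition momentum_cutoff :: "real \<Rightarrow> ('d::finite, 'c::finite) state set" where
  "momentum_cutoff L = {\<psi> \<in> L2. \<exists>\<phi> \<in> L2.
     (\<forall>p. (\<exists>b. \<bar>p $ b\<bar> > L) \<longrightarrow> \<phi> p = 0) \<and>
     (AE x in lborel. \<psi> x =
        (2 * pi) powr (- real CARD('d) / 2) *\<^sub>R (LINT p|lborel. cis (p \<bullet> x) *s \<phi> p))}"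

definition cutoff_norm ::
    "real \<Rightarrow> (('d::finite, 'c::finite) state \<Rightarrow> ('d, 'c) state) \<Rightarrow> ennreal" where
  "cutoff_norm L T = (SUP \<psi>\<in>{\<psi> \<in> momentum_cutoff L. L2_norm \<psi> \<le> 1}. L2_norm (T \<psi>))"

(* One step of the walk on the continuum space, where the shift by q is exp (- i a q . P). *)
definition walk_step ::
    "(int ^ 'd) set \<Rightarrow> (int ^ 'd \<Rightarrow> complex ^ 'c ^ 'c) \<Rightarrow> complex ^ 'c ^ 'c \<Rightarrow> real \<Rightarrow>
     ('d::finite, 'c::finite) state \<Rightarrow> ('d, 'c) state" where
  "walk_step Q A M a \<psi> = (\<lambda>x.
     matrix_exp (mat (- \<i> * of_real a) ** M) *v
       (\<Sum>q\<in>Q. A q *v op_exp (- \<i> * of_real a) (dot_momentum q) \<psi> x))"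

definition hamiltonian ::
    "(int ^ 'd) set \<Rightarrow> (int ^ 'd \<Rightarrow> complex ^ 'c ^ 'c) \<Rightarrow> complex ^ 'c ^ 'c \<Rightarrow>
     ('d::finite, 'c::finite) state \<Rightarrow> ('d, 'c) state" where
  "hamiltonian Q A M \<psi> = (\<lambda>x. (\<Sum>q\<in>Q. A q *v dot_momentum q \<psi> x) + M *v \<psi> x)"

(* The lattice spacing tends to 0 through the values for which t / a is an integer. *)
definition spacing_to_0 :: "real \<Rightarrow> real filter" where
  "spacing_to_0 t = at 0 within {a. a > 0 \<and> t / a \<in> \<int>}"

end

(*
The continuum momentum operators act on a band-limited state as multiplication of its amplitude, so
both exp (- i H t) and the N-th power of the walk step are Fourier multipliers with matrix symbols.
By Plancherel's theorem (proved here with Gaussian weights: the weighted energy of a Fourier transform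
is a Gaussian average of the autocorrelation, which is continuous at 0) the cutoff norm of the
difference is at most the supremum over the momentum cube of the operator norm of the difference of
symbols. Testing unitarity of the lattice walk on delta states shows that the symbol W(a p) of the walk
is isometric. As W(0) = 1, one step exp (- i a M) W(a p) differs from exp (- i a H(p)) by
O (a^2 L^2) for momenta below L, and telescoping over N = t / a steps gives O (t L^2 a).
*)
theory Submission
  imports Defs "HOL-Probability.Characteristic_Functions"
begin

section \<open>Square integrable functions\<close>

text \<open>States are classes modulo null sets, and both \<open>L2_partial\<close> and
  \<open>op_exp\<close> pick a limit by \<open>SOME\<close>, so their values are fixed only almost
  everywhere, and only where a limit exists. The calculus is therefore carried by a relation
  \<open>represents\<close> between a state and a momentum amplitude, stable under changes on null
  sets; uniqueness of L2 limits then pins down every choice. Amplitudes vanish outside a cube, hence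
  are integrable, and Plancherel is needed only for such functions. Their autocorrelation is
  continuous at 0 because translation is continuous in the mean, which reduces to continuous
  functions of compact support. The Gaussian weight makes Fubini applicable before the transform is
  known to be square integrable. Coin matrices are moved into a Banach algebra with the operator
  norm, where exponentials and products of noncommuting elements can be estimated. There exp (- i a
  H(p)) is bounded by comparison with the walk step, at the price of factors exp (m a) and exp (C (a
  L)^2), whose N-th powers stay bounded.\<close>

lemma integral_lborel_affine:
  fixes f :: "'a::euclidean_space \<Rightarrow> 'b::{banach, second_countable_topology}"
  assumes c: "c \<noteq> 0" and [measurable]: "f \<in> borel_measurable borel"
  shows "integral\<^sup>L lborel f = \<bar>c\<bar> ^ DIM('a) *\<^sub>R (LINT x|lborel. f (t + c *\<^sub>R x))"
  by (subst lborel_affine[OF c, of t]) (simp add: integral_density integral_distr)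

lemma integrable_lborel_affine_iff:
  fixes f :: "'a::euclidean_space \<Rightarrow> 'b::{banach, second_countable_topology}"
  assumes c: "c \<noteq> 0" and [measurable]: "f \<in> borel_measurable borel"
  shows "integrable lborel (\<lambda>x. f (t + c *\<^sub>R x)) \<longleftrightarrow> integrable lborel f"
proof -
  have "integrable lborel f \<longleftrightarrow>
      integrable (density (distr lborel borel (\<lambda>x. t + c *\<^sub>R x)) (\<lambda>_. ennreal (\<bar>c\<bar> ^ DIM('a)))) f"
    by (subst lborel_affine[OF c, of t]) (simp add: ennreal_power)
  also have "\<dots> \<longleftrightarrow> integrable lborel (\<lambda>x. f (t + c *\<^sub>R x))"
  proof -
    have iff: "integrable lborel (\<lambda>x. k *\<^sub>R g x) \<longleftrightarrow> integrable lborel g" if "k \<noteq> 0"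
      for g :: "'a \<Rightarrow> 'b" and k :: real
    proof
      assume "integrable lborel (\<lambda>x. k *\<^sub>R g x)"
      then have "integrable lborel (\<lambda>x. inverse k *\<^sub>R (k *\<^sub>R g x))"
        by (rule integrable_scaleR_right)
      then show "integrable lborel g" using that by simp
    qed (rule integrable_scaleR_right)
    have "\<bar>c\<bar> ^ DIM('a) \<noteq> 0" using c by simp
    then show ?thesis
      by (subst integrable_density) (simp_all add: integrable_distr_eq iff)
  qed
  finally show ?thesis by simp
qed

lemma integral_lborel_translate:
  fixes f :: "'a::euclidean_space \<Rightarrow> 'b::{banach, second_countable_topology}"
  assumes "f \<in> borel_measurable borel"
  shows "(LINT x|lborel. f (x + t)) = integral\<^sup>L lborel f"
  using integral_lborel_affine[of 1 f t] assms by (simp add: add.commute)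

lemma integrable_lborel_translate_iff:
  fixes f :: "'a::euclidean_space \<Rightarrow> 'b::{banach, second_countable_topology}"
  assumes "f \<in> borel_measurable borel"
  shows "integrable lborel (\<lambda>x. f (x + t)) \<longleftrightarrow> integrable lborel f"
  using integrable_lborel_affine_iff[of 1 f t] assms by (simp add: add.commute)

lemma AE_lborel_translate:
  fixes P :: "'a::euclidean_space \<Rightarrow> bool"
  assumes "AE x in lborel. P x"
  shows "AE x in lborel. P (x + t)"
proof -
  have "AE x in distr lborel borel ((+) t). P x"
    unfolding lborel_distr_plus by (rule assms)
  then have "AE x in lborel. P (t + x)"
    by (rule AE_distrD[rotated]) simp
  then show ?thesis by (simp add: add.commute)
qed

text \<open>Any Euclidean range is allowed, so that the same facts serve scalar components and
  coin-valued states; on states this is membership in \<open>L2\<close>.\<close>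

definition square_integrable :: "('a::euclidean_space \<Rightarrow> 'b::euclidean_space) \<Rightarrow> bool" where
  "square_integrable f \<longleftrightarrow>
     f \<in> borel_measurable borel \<and> integrable lborel (\<lambda>x. (norm (f x))\<^sup>2)"

lemma norm_add_power2_le:
  fixes x y :: "'a::real_normed_vector"
  shows "(norm (x + y))\<^sup>2 \<le> 2 * (norm x)\<^sup>2 + 2 * (norm y)\<^sup>2"
proof -
  have "(norm (x + y))\<^sup>2 \<le> (norm x + norm y)\<^sup>2"
    by (intro power_mono norm_triangle_ineq) simp
  also have "\<dots> \<le> 2 * (norm x)\<^sup>2 + 2 * (norm y)\<^sup>2"
    using sum_squares_bound[of "norm x" "norm y"] by (simp add: power2_sum)
  finally show ?thesis .
qed

lemma square_integrable_integrable:
  "square_integrable f \<Longrightarrow> integrable lborel (\<lambda>x. (norm (f x))\<^sup>2)"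
  by (simp add: square_integrable_def)

lemma square_integrable_bound:
  fixes f :: "'a::euclidean_space \<Rightarrow> 'b::euclidean_space"
  assumes "f \<in> borel_measurable borel" "integrable lborel g"
    and "AE x in lborel. (norm (f x))\<^sup>2 \<le> g x"
  shows "square_integrable f"
  unfolding square_integrable_def
proof
  show "integrable lborel (\<lambda>x. (norm (f x))\<^sup>2)"
  proof (rule Bochner_Integration.integrable_bound[OF assms(2)])
    show "AE x in lborel. norm ((norm (f x))\<^sup>2) \<le> norm (g x)"
      using assms(3) by eventually_elim auto
  qed (use assms(1) in measurable)
qed fact

lemma square_integrable_add:
  assumes "square_integrable f" "square_integrable g"
  shows "square_integrable (\<lambda>x. f x + g x)"
proof (rule square_integrable_bound)
  show "integrable lborel (\<lambda>x. 2 * (norm (f x))\<^sup>2 + 2 * (norm (g x))\<^sup>2)"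
    using assms by (simp add: square_integrable_def)
qed (use assms in \<open>auto simp: square_integrable_def norm_add_power2_le\<close>)

lemma square_integrable_uminus:
  "square_integrable f \<Longrightarrow> square_integrable (\<lambda>x. - f x)"
  by (simp add: square_integrable_def)

lemma square_integrable_diff:
  assumes "square_integrable f" "square_integrable g"
  shows "square_integrable (\<lambda>x. f x - g x)"
  using square_integrable_add[OF assms(1) square_integrable_uminus[OF assms(2)]] by simp

lemma square_integrable_translate:
  fixes f :: "'a::euclidean_space \<Rightarrow> 'b::euclidean_space"
  assumes f: "square_integrable f"
  shows "square_integrable (\<lambda>x. f (x + t))"
  unfolding square_integrable_def
proof
  have [measurable]: "f \<in> borel_measurable borel" using f by (simp add: square_integrable_def)
  show "(\<lambda>x. f (x + t)) \<in> borel_measurable borel" by measurable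
  show "integrable lborel (\<lambda>x. (norm (f (x + t)))\<^sup>2)"
    using f by (subst integrable_lborel_translate_iff[of "\<lambda>x. (norm (f x))\<^sup>2"])
      (auto simp: square_integrable_def)
qed

text \<open>Stands in for the L2 triangle inequality. The factor 2 disappears into an epsilon, or is
  no loss at all when both functions have the same norm.\<close>

lemma integral_norm_add_power2_le:
  fixes f g :: "'a::euclidean_space \<Rightarrow> 'b::euclidean_space"
  assumes "square_integrable f" "square_integrable g"
  shows "(LINT x|lborel. (norm (f x + g x))\<^sup>2)
    \<le> 2 * (LINT x|lborel. (norm (f x))\<^sup>2) + 2 * (LINT x|lborel. (norm (g x))\<^sup>2)"
proof -
  have "(LINT x|lborel. (norm (f x + g x))\<^sup>2)
      \<le> (LINT x|lborel. 2 * (norm (f x))\<^sup>2 + 2 * (norm (g x))\<^sup>2)"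
    using square_integrable_add[OF assms] assms
    by (intro integral_mono norm_add_power2_le) (auto simp: square_integrable_def)
  also have "\<dots> = 2 * (LINT x|lborel. (norm (f x))\<^sup>2) + 2 * (LINT x|lborel. (norm (g x))\<^sup>2)"
    using assms by (simp add: square_integrable_def)
  finally show ?thesis .
qed

section \<open>Continuity of translation in the mean\<close>

text \<open>Sequences are used because dominated convergence is a statement about sequences. Square
  integrability is included since a non-integrable function has integral 0 by convention, which
  could make the limit hold for the wrong reason.\<close>

definition translation_continuous :: "('a::euclidean_space \<Rightarrow> 'b::euclidean_space) \<Rightarrow> bool" where
  "translation_continuous f \<longleftrightarrow> square_integrable f \<and>
     (\<forall>Y. Y \<longlonglongrightarrow> 0 \<longrightarrow> (\<lambda>n. LINT x|lborel. (norm (f (x + Y n) - f x))\<^sup>2) \<longlonglongrightarrow> 0)"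

lemma integrable_indicator_cball:
  "integrable lborel (indicator (cball (0::'a::euclidean_space) R) :: 'a \<Rightarrow> real)"
  using emeasure_lborel_cball_finite[of "0::'a" R] by (intro integrable_real_indicator) (auto simp: less_top)

lemma translation_continuous_compact_support:
  fixes g :: "'a::euclidean_space \<Rightarrow> 'b::euclidean_space"
  assumes cont: "continuous_on UNIV g" and zero: "\<And>x. norm x > R \<Longrightarrow> g x = 0"
    and bound: "\<And>x. norm (g x) \<le> B"
  shows "translation_continuous g"
  unfolding translation_continuous_def
proof (intro conjI allI impI)
  have [measurable]: "g \<in> borel_measurable borel"
    using cont by (rule borel_measurable_continuous_onI)
  have B: "0 \<le> B" using bound[of 0] norm_ge_zero order_trans by blast
  show "square_integrable g"
  proof (rule square_integrable_bound)
    show "integrable lborel (\<lambda>x. B\<^sup>2 * indicator (cball 0 R) x)"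
      by (intro integrable_mult_right integrable_indicator_cball)
    have "(norm (g x))\<^sup>2 \<le> B\<^sup>2 * indicator (cball 0 R) x" for x
      using zero[of x] power_mono[OF bound[of x], of 2] by (auto simp: indicator_def)
    then show "AE x in lborel. (norm (g x))\<^sup>2 \<le> B\<^sup>2 * indicator (cball 0 R) x" by simp
  qed measurable
  fix Y :: "nat \<Rightarrow> 'a" assume Y: "Y \<longlonglongrightarrow> 0"
  \<comment> \<open>A convergent sequence of shifts is bounded, so all differences live in one ball
    of radius \<open>R + K\<close>, and a multiple of its indicator dominates.\<close>
  then obtain K where K: "\<And>n. norm (Y n) \<le> K"
    using convergent_imp_bounded[of Y 0] by (auto simp: bounded_iff)
  have K0: "0 \<le> K" using K[of 0] norm_ge_zero order_trans by blast
  have "(\<lambda>n. LINT x|lborel. (norm (g (x + Y n) - g x))\<^sup>2) \<longlonglongrightarrow> (LINT x|(lborel::'a measure). (0::real))"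
  proof (rule integral_dominated_convergence)
    show "integrable lborel (\<lambda>x. (2*B)\<^sup>2 * indicator (cball (0::'a) (R + K)) x :: real)"
      by (intro integrable_mult_right integrable_indicator_cball)
    show "AE x in lborel. (\<lambda>n. (norm (g (x + Y n) - g x))\<^sup>2) \<longlonglongrightarrow> 0"
    proof (rule AE_I2)
      fix x
      have "isCont g x" using cont by (simp add: continuous_on_eq_continuous_at)
      moreover have "(\<lambda>n. x + Y n) \<longlonglongrightarrow> x" using tendsto_add[OF tendsto_const[of x] Y] by simp
      ultimately have "(\<lambda>n. g (x + Y n)) \<longlonglongrightarrow> g x" by (rule isCont_tendsto_compose)
      then have "(\<lambda>n. norm (g (x + Y n) - g x)) \<longlonglongrightarrow> 0"
        by (simp add: LIM_zero tendsto_norm_zero)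
      from tendsto_power[OF this, of 2] show "(\<lambda>n. (norm (g (x + Y n) - g x))\<^sup>2) \<longlonglongrightarrow> 0" by simp
    qed
    show "AE x in lborel. norm ((norm (g (x + Y n) - g x))\<^sup>2) \<le> (2*B)\<^sup>2 * indicator (cball 0 (R+K)) x" for n
    proof (rule AE_I2)
      fix x
      show "norm ((norm (g (x + Y n) - g x))\<^sup>2) \<le> (2*B)\<^sup>2 * indicator (cball 0 (R+K)) x"
      proof (cases "norm x \<le> R + K")
        case True
        have "norm (g (x + Y n) - g x) \<le> 2*B"
          using norm_triangle_ineq4[of "g (x + Y n)" "g x"] bound[of x] bound[of "x + Y n"] by linarith
        then have "(norm (g (x + Y n) - g x))\<^sup>2 \<le> (2*B)\<^sup>2" by (intro power_mono) auto
        then show ?thesis using True by simp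
      next
        case False
        then have "norm x > R" using K0 by linarith
        moreover have "norm (x + Y n) > R"
          using False K[of n] norm_triangle_ineq4[of "x + Y n" "Y n"] by simp
        ultimately show ?thesis using zero by simp
      qed
    qed
  qed measurable
  then show "(\<lambda>n. LINT x|lborel. (norm (g (x + Y n) - g x))\<^sup>2) \<longlonglongrightarrow> 0" by simp
qed

text \<open>Translation does not change the L2 norm of \<open>f - g\<close>, so an approximation of
  \<open>f\<close> by \<open>g\<close> stays equally good after every shift.\<close>

lemma translation_continuous_closed:
  fixes f :: "'a::euclidean_space \<Rightarrow> 'b::euclidean_space"
  assumes f: "square_integrable f"
    and approx: "\<And>e. e > 0 \<Longrightarrow> \<exists>g. translation_continuous g \<and> (LINT x|lborel. (norm (f x - g x))\<^sup>2) < e"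
  shows "translation_continuous f"
  unfolding translation_continuous_def
proof (intro conjI allI impI f)
  fix Y :: "nat \<Rightarrow> 'a" assume Y: "Y \<longlonglongrightarrow> 0"
  show "(\<lambda>n. LINT x|lborel. (norm (f (x + Y n) - f x))\<^sup>2) \<longlonglongrightarrow> 0"
  proof (rule tendstoI)
    fix e :: real assume "e > 0"
    \<comment> \<open>Using the factor-2 inequality twice gives
      \<open>2 * (e/8) + 8 * (e/12)\<close>, which is 11/12 of \<open>e\<close>.\<close>
    then obtain g where g: "translation_continuous g"
      and fg: "(LINT x|lborel. (norm (f x - g x))\<^sup>2) < e / 12"
      using approx[of "e/12"] by auto
    have gS: "square_integrable g" and
      lim: "(\<lambda>n. LINT x|lborel. (norm (g (x + Y n) - g x))\<^sup>2) \<longlonglongrightarrow> 0"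
      using g Y by (auto simp: translation_continuous_def)
    have "\<forall>\<^sub>F n in sequentially. (LINT x|lborel. (norm (g (x + Y n) - g x))\<^sup>2) < e / 8"
      using order_tendstoD(2)[OF lim, of "e/8"] \<open>e > 0\<close> by simp
    then show "\<forall>\<^sub>F n in sequentially. dist (LINT x|lborel. (norm (f (x + Y n) - f x))\<^sup>2) 0 < e"
    proof eventually_elim
      case (elim n)
      note S = square_integrable_translate[OF f, of "Y n"] square_integrable_translate[OF gS, of "Y n"]
      have [measurable]: "f \<in> borel_measurable borel" "g \<in> borel_measurable borel"
        using f gS by (auto simp: square_integrable_def)
      let ?d = "\<lambda>x. f x - g x"
      have eq: "f (x + Y n) - f x = (g (x + Y n) - g x) + (?d (x + Y n) - ?d x)" for x by simp
      have 1: "(LINT x|lborel. (norm (f (x + Y n) - f x))\<^sup>2)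
          \<le> 2 * (LINT x|lborel. (norm (g (x + Y n) - g x))\<^sup>2)
            + 2 * (LINT x|lborel. (norm (?d (x + Y n) + - ?d x))\<^sup>2)"
        unfolding eq add_uminus_conv_diff
        by (rule integral_norm_add_power2_le) (intro square_integrable_diff S f gS)+
      have 2: "(LINT x|lborel. (norm (?d (x + Y n) + - ?d x))\<^sup>2)
          \<le> 2 * (LINT x|lborel. (norm (?d (x + Y n)))\<^sup>2) + 2 * (LINT x|lborel. (norm (- ?d x))\<^sup>2)"
        by (rule integral_norm_add_power2_le)
          (intro square_integrable_diff square_integrable_uminus S f gS)+
      have 3: "(LINT x|lborel. (norm (?d (x + Y n)))\<^sup>2) = (LINT x|lborel. (norm (?d x))\<^sup>2)"
        by (rule integral_lborel_translate) measurable
      from 1 2 3 have "(LINT x|lborel. (norm (f (x + Y n) - f x))\<^sup>2) < e"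
        using elim fg \<open>e > 0\<close> unfolding norm_minus_cancel by linarith
      moreover have "0 \<le> (LINT x|lborel. (norm (f (x + Y n) - f x))\<^sup>2)" by simp
      ultimately show ?case by simp
    qed
  qed
qed

text \<open>Measurability supplies continuous functions converging to \<open>f\<close> off a null
  set; clipping their values and cutting off their support makes them admissible and gives the
  domination.\<close>

lemma translation_continuous_bounded:
  fixes f :: "'a::euclidean_space \<Rightarrow> 'b::euclidean_space"
  assumes [measurable]: "f \<in> borel_measurable borel"
    and zero: "\<And>x. norm x > R \<Longrightarrow> f x = 0" and bound: "\<And>x. norm (f x) \<le> B"
  shows "translation_continuous f"
proof -
  have B: "0 \<le> B" using bound[of 0] norm_ge_zero order_trans by blast
  have "f measurable_on UNIV"
    by (intro lebesgue_measurable_imp_measurable_on measurable_completion) simp_all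
  then obtain N g where N: "negligible N" and g: "\<And>n. continuous_on UNIV (g n)"
    and lim: "\<And>x. x \<notin> N \<Longrightarrow> (\<lambda>n. g n x) \<longlonglongrightarrow> f x"
    unfolding measurable_on_def by auto
  \<comment> \<open>The nearest-point projection onto the ball of radius \<open>B\<close> is
    continuous and fixes the values of \<open>f\<close>, so it bounds the approximants without
    spoiling their limit.\<close>
  define clip where "clip = (closest_point (cball (0::'b) B))"
  have clip_in: "norm (clip y) \<le> B" for y
    using closest_point_in_set[of "cball 0 B" y] B by (auto simp: clip_def)
  have clip_cont: "continuous_on UNIV clip"
    unfolding clip_def using B by (intro continuous_on_closest_point) auto
  have clip_id: "clip y = y" if "norm y \<le> B" for y
    using closest_point_self[of y "cball 0 B"] that by (simp add: clip_def)
  \<comment> \<open>The ramp of unit width keeps the product continuous, and it equals 1 wherever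
    \<open>f\<close> can be nonzero.\<close>
  define w where "w = (\<lambda>x::'a. max 0 (min 1 (1 + R - norm x)))"
  have w: "0 \<le> w x" "w x \<le> 1" "norm x \<le> R \<Longrightarrow> w x = 1" "norm x > R + 1 \<Longrightarrow> w x = 0" for x
    by (auto simp: w_def)
  have w_cont: "continuous_on UNIV w" unfolding w_def by (intro continuous_intros)
  define h where "h = (\<lambda>n x. w x *\<^sub>R clip (g n x))"
  have h_cont: "continuous_on UNIV (h n)" for n
    unfolding h_def by (intro continuous_intros w_cont continuous_on_compose2[OF clip_cont g]) auto
  have [measurable]: "h n \<in> borel_measurable borel" for n
    using h_cont by (rule borel_measurable_continuous_onI)
  have h_bound: "norm (h n x) \<le> B" for n x
  proof -
    have "norm (h n x) \<le> 1 * B"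
      unfolding h_def norm_scaleR using w[of x] clip_in B by (intro mult_mono) auto
    then show ?thesis by simp
  qed
  have h_zero: "h n x = 0" if "norm x > R + 1" for n x
    using w(4)[OF that] by (simp add: h_def)
  have h_tc: "translation_continuous (h n)" for n
    by (rule translation_continuous_compact_support[OF h_cont h_zero h_bound])
  have h_lim: "(\<lambda>n. h n x) \<longlonglongrightarrow> f x" if "x \<notin> N" for x
  proof -
    have "isCont clip (f x)" using clip_cont by (simp add: continuous_on_eq_continuous_at)
    then have "(\<lambda>n. clip (g n x)) \<longlonglongrightarrow> clip (f x)" using lim[OF that] by (rule isCont_tendsto_compose)
    then have "(\<lambda>n. h n x) \<longlonglongrightarrow> w x *\<^sub>R clip (f x)" unfolding h_def by (intro tendsto_intros)
    moreover have "w x *\<^sub>R clip (f x) = f x"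
      using clip_id[OF bound[of x]] w(3)[of x] zero[of x] by (cases "norm x \<le> R") auto
    ultimately show ?thesis by simp
  qed
  have "N \<in> null_sets lebesgue" using N by (simp add: negligible_iff_null_sets)
  then have "AE x in lebesgue. x \<notin> N" by (rule AE_not_in)
  then have AEN: "AE x in lborel. x \<notin> N" by (simp add: AE_completion_iff)
  have "(\<lambda>n. LINT x|lborel. (norm (f x - h n x))\<^sup>2) \<longlonglongrightarrow> (LINT x|(lborel::'a measure). (0::real))"
  proof (rule integral_dominated_convergence)
    show "integrable lborel (\<lambda>x. (2*B)\<^sup>2 * indicator (cball (0::'a) (R + 1)) x :: real)"
      by (intro integrable_mult_right integrable_indicator_cball)
    show "AE x in lborel. (\<lambda>n. (norm (f x - h n x))\<^sup>2) \<longlonglongrightarrow> 0"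
      using AEN
    proof eventually_elim
      case (elim x)
      have "(\<lambda>n. (norm (f x - h n x))\<^sup>2) \<longlonglongrightarrow> (norm (f x - f x))\<^sup>2"
        by (intro tendsto_intros h_lim[OF elim])
      then show ?case by simp
    qed
    show "AE x in lborel. norm ((norm (f x - h n x))\<^sup>2) \<le> (2*B)\<^sup>2 * indicator (cball 0 (R+1)) x" for n
    proof (rule AE_I2)
      fix x
      have "norm (f x - h n x) \<le> 2*B"
        using norm_triangle_ineq4[of "f x" "h n x"] bound[of x] h_bound[of n x] by linarith
      then have "(norm (f x - h n x))\<^sup>2 \<le> (2*B)\<^sup>2" by (intro power_mono) auto
      then show "norm ((norm (f x - h n x))\<^sup>2) \<le> (2*B)\<^sup>2 * indicator (cball 0 (R+1)) x"
        using h_zero[of x n] zero[of x] by (auto simp: indicator_def)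
    qed
  qed measurable
  then have L: "(\<lambda>n. LINT x|lborel. (norm (f x - h n x))\<^sup>2) \<longlonglongrightarrow> 0" by simp
  have fS: "square_integrable f"
  proof (rule square_integrable_bound)
    show "integrable lborel (\<lambda>x. B\<^sup>2 * indicator (cball 0 R) x)"
      by (intro integrable_mult_right integrable_indicator_cball)
    have "(norm (f x))\<^sup>2 \<le> B\<^sup>2 * indicator (cball 0 R) x" for x
      using zero[of x] power_mono[OF bound[of x], of 2] by (auto simp: indicator_def)
    then show "AE x in lborel. (norm (f x))\<^sup>2 \<le> B\<^sup>2 * indicator (cball 0 R) x" by simp
  qed measurable
  show ?thesis
  proof (rule translation_continuous_closed[OF fS])
    fix e :: real assume "e > 0"
    then obtain n where "(LINT x|lborel. (norm (f x - h n x))\<^sup>2) < e"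
      using order_tendstoD(2)[OF L, of e] by (auto simp: eventually_sequentially)
    then show "\<exists>g. translation_continuous g \<and> (LINT x|lborel. (norm (f x - g x))\<^sup>2) < e"
      using h_tc by blast
  qed
qed

text \<open>Unboundedness is removed by dropping the values of norm above \<open>n\<close>; the
  squared error is dominated by the squared norm of \<open>f\<close>.\<close>

lemma translation_continuous_bounded_support:
  fixes f :: "'a::euclidean_space \<Rightarrow> 'b::euclidean_space"
  assumes f: "square_integrable f" and zero: "\<And>x. norm x > R \<Longrightarrow> f x = 0"
  shows "translation_continuous f"
proof -
  have [measurable]: "f \<in> borel_measurable borel" using f by (simp add: square_integrable_def)
  define h where "h = (\<lambda>(n::nat) x. if norm (f x) \<le> real n then f x else 0)"
  have [measurable]: "h n \<in> borel_measurable borel" for n unfolding h_def by measurable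
  have h_tc: "translation_continuous (h n)" for n
    by (rule translation_continuous_bounded[where R = R and B = n]) (auto simp: h_def zero)
  have "(\<lambda>n. LINT x|lborel. (norm (f x - h n x))\<^sup>2) \<longlonglongrightarrow> (LINT x|(lborel::'a measure). (0::real))"
  proof (rule integral_dominated_convergence)
    show "integrable lborel (\<lambda>x. (norm (f x))\<^sup>2)" using f by (simp add: square_integrable_def)
    show "AE x in lborel. (\<lambda>n. (norm (f x - h n x))\<^sup>2) \<longlonglongrightarrow> 0"
    proof (rule AE_I2)
      fix x
      obtain m where "norm (f x) \<le> real m" using real_arch_simple by blast
      then have "\<forall>\<^sub>F n in sequentially. (norm (f x - h n x))\<^sup>2 = 0"
        unfolding eventually_sequentially h_def by (auto intro!: exI[of _ m])
      then show "(\<lambda>n. (norm (f x - h n x))\<^sup>2) \<longlonglongrightarrow> 0" by (rule tendsto_eventually)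
    qed
  qed (auto simp: h_def)
  then have L: "(\<lambda>n. LINT x|lborel. (norm (f x - h n x))\<^sup>2) \<longlonglongrightarrow> 0" by simp
  show ?thesis
  proof (rule translation_continuous_closed[OF f])
    fix e :: real assume "e > 0"
    then obtain n where "(LINT x|lborel. (norm (f x - h n x))\<^sup>2) < e"
      using order_tendstoD(2)[OF L, of e] by (auto simp: eventually_sequentially)
    then show "\<exists>g. translation_continuous g \<and> (LINT x|lborel. (norm (f x - g x))\<^sup>2) < e"
      using h_tc by blast
  qed
qed

section \<open>Plancherel's theorem\<close>

text \<open>Normalised to 1 at the origin rather than to total mass 1: shrinking the scale of the
  argument lets the weight increase to 1, so that monotone convergence removes it.\<close>

definition gaussian :: "'a::euclidean_space \<Rightarrow> real" where
  "gaussian x = exp (- (norm x)\<^sup>2 / 2)"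

lemma gaussian_pos: "0 < gaussian x" and gaussian_le_1: "gaussian x \<le> 1"
  by (simp_all add: gaussian_def)

lemma borel_measurable_gaussian [measurable]: "gaussian \<in> borel_measurable borel"
  unfolding gaussian_def by measurable

lemma borel_measurable_cis [measurable]: "cis \<in> borel_measurable borel"
  by (intro borel_measurable_continuous_onI continuous_intros continuous_on_cis continuous_on_id)

lemma borel_measurable_cnj [measurable]: "cnj \<in> borel_measurable borel"
  by (intro borel_measurable_continuous_onI continuous_intros)

text \<open>This is the characteristic function of the standard normal distribution, freed of the
  normalising factor of the density.\<close>

lemma gaussian_fourier_real:
  "has_bochner_integral lborel (\<lambda>x::real. cis (u * x) * of_real (exp (- x\<^sup>2 / 2)))
     (of_real (sqrt (2 * pi) * exp (- u\<^sup>2 / 2)))"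
proof -
  have eq: "cis (u * x) * of_real (exp (- x\<^sup>2 / 2))
      = of_real (sqrt (2 * pi)) * (std_normal_density x *\<^sub>R iexp (u * x))" for x
    by (simp add: std_normal_density_def cis_conv_exp scaleR_conv_of_real)
  have int: "integrable lborel (\<lambda>x. std_normal_density x *\<^sub>R iexp (u * x))"
    by (rule Bochner_Integration.integrable_bound[OF integrable_normal_density[of 1 0]]) auto
  have "(LINT x|lborel. std_normal_density x *\<^sub>R iexp (u * x)) = char std_normal_distribution u"
    unfolding char_def by (subst integral_density) auto
  also have "\<dots> = of_real (exp (- u\<^sup>2 / 2))"
    by (simp add: char_std_normal_distribution)
  finally show ?thesis
    unfolding eq of_real_mult using int
    by (intro has_bochner_integral_mult_right) (simp add: has_bochner_integral_iff)
qed

text \<open>Lebesgue measure is the image of a product over \<open>Basis\<close>, and phase and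
  Gaussian factorise along it, which leaves the one-dimensional integral. Integrability is the case
  \<open>u = 0\<close>.\<close>

lemma
  fixes u :: "'a::euclidean_space"
  shows gaussian_fourier: "(LINT x|lborel. cis (u \<bullet> x) * of_real (gaussian x))
    = of_real (sqrt (2 * pi) ^ DIM('a) * gaussian u)"
    and integrable_gaussian: "integrable lborel (gaussian :: 'a \<Rightarrow> real)"
proof -
  interpret product_sigma_finite "\<lambda>b::'a. lborel :: real measure" ..
  define G where "G = (\<lambda>(u::'a) b x. cis ((u \<bullet> b) * x) * complex_of_real (exp (- x\<^sup>2 / 2)))"
  have G: "integrable lborel (G u b)" "integral\<^sup>L lborel (G u b) = of_real (sqrt (2 * pi) * exp (- (u \<bullet> b)\<^sup>2 / 2))"
    for u b :: 'a
    using gaussian_fourier_real[of "u \<bullet> b"] by (auto simp: G_def has_bochner_integral_iff)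
  have norm_sq: "(norm x)\<^sup>2 = (\<Sum>b\<in>Basis. (x \<bullet> b)\<^sup>2)" for x :: 'a
    by (metis (no_types, lifting) euclidean_inner power2_eq_square power2_norm_eq_inner sum.cong)
  have gprod: "gaussian x = (\<Prod>b\<in>Basis. exp (- (x \<bullet> b)\<^sup>2 / 2))" for x :: 'a
    by (simp add: gaussian_def norm_sq sum_negf[symmetric] sum_divide_distrib exp_sum)
  have cprod: "cis (u \<bullet> x) = (\<Prod>b\<in>Basis. cis ((u \<bullet> b) * (x \<bullet> b)))" for u x :: 'a
    unfolding cis_conv_exp by (subst euclidean_inner) (simp add: sum_distrib_left exp_sum)
  have eq: "cis (u \<bullet> x) * of_real (gaussian x) = (\<Prod>b\<in>Basis. G u b (x \<bullet> b))" for u x :: 'a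
    unfolding cprod gprod by (simp add: G_def prod.distrib)
  have [measurable]: "G u b \<in> borel_measurable borel" for u b :: 'a
    unfolding G_def by measurable
  have comp: "(\<Sum>b\<in>Basis. f b *\<^sub>R b) \<bullet> c = f c" if "c \<in> Basis" for f :: "'a \<Rightarrow> real" and c
    using that by (simp add: inner_sum_left inner_Basis if_distrib cong: if_cong)
  have prod_comp: "(\<Prod>b\<in>Basis. G u b ((\<Sum>c\<in>Basis. f c *\<^sub>R c) \<bullet> b)) = (\<Prod>b\<in>Basis. G u b (f b))" for u :: 'a and f
    by (intro prod.cong refl) (simp add: comp)
  have "(LINT x|lborel. cis (u \<bullet> x) * of_real (gaussian x))
      = (LINT f|(Pi\<^sub>M Basis (\<lambda>_. lborel)). (\<Prod>b\<in>Basis. G u b (f b)))"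
    unfolding eq by (subst lborel_eq) (simp add: integral_distr prod_comp)
  also have "\<dots> = (\<Prod>b\<in>Basis. integral\<^sup>L lborel (G u b))"
    by (intro product_integral_prod G) simp
  also have "\<dots> = of_real (sqrt (2 * pi) ^ DIM('a) * gaussian u)"
    by (simp add: G prod.distrib gprod)
  finally show "(LINT x|lborel. cis (u \<bullet> x) * of_real (gaussian x))
    = of_real (sqrt (2 * pi) ^ DIM('a) * gaussian u)" .
  have "integrable (Pi\<^sub>M Basis (\<lambda>_. lborel)) (\<lambda>f. \<Prod>b\<in>Basis. G (0::'a) b (f b))"
    by (intro product_integrable_prod G) simp
  then have "integrable lborel (\<lambda>x. \<Prod>b\<in>Basis. G (0::'a) b (x \<bullet> b))"
    by (subst lborel_eq) (simp add: integrable_distr_eq prod_comp)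
  then have "integrable lborel (\<lambda>x::'a. complex_of_real (gaussian x))"
    unfolding eq[symmetric] by simp
  then show "integrable lborel (gaussian :: 'a \<Rightarrow> real)"
    by (rule Bochner_Integration.integrable_bound) auto
qed

text \<open>The power of \<epsilon> is the Jacobian of the later substitution of
  \<open>q + \<epsilon> *\<^sub>R h\<close> for \<open>p\<close>; kernel and Jacobian together form
  a Gaussian in \<open>h\<close> that no longer depends on \<epsilon>.\<close>

lemma gaussian_fourier_scaled:
  fixes u :: "'a::euclidean_space"
  assumes "\<epsilon> > 0"
  shows "complex_of_real (\<epsilon> ^ DIM('a)) * (LINT x|lborel. cis (\<epsilon> * (u \<bullet> x)) * of_real (gaussian (\<epsilon> *\<^sub>R x)))
    = of_real (sqrt (2 * pi) ^ DIM('a) * gaussian u)"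
proof -
  have "(LINT x|lborel. cis (u \<bullet> x) * complex_of_real (gaussian x))
      = \<bar>\<epsilon>\<bar> ^ DIM('a) *\<^sub>R (LINT x|lborel. cis (u \<bullet> (0 + \<epsilon> *\<^sub>R x)) * of_real (gaussian (0 + \<epsilon> *\<^sub>R x)))"
    by (rule integral_lborel_affine) (use assms in \<open>auto simp: cis_conv_exp\<close>)
  then show ?thesis using assms by (simp add: gaussian_fourier scaleR_conv_of_real)
qed

lemma integral_gaussian: "(LINT x|lborel. gaussian (x::'a::euclidean_space)) = sqrt (2 * pi) ^ DIM('a)"
proof -
  have "complex_of_real (LINT x|lborel. gaussian (x::'a)) = of_real (sqrt (2 * pi) ^ DIM('a))"
    using gaussian_fourier[of "0::'a"] by (simp add: gaussian_def)
  then show ?thesis by (simp only: of_real_eq_iff)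
qed

text \<open>The sign is that of the plane waves in \<open>momentum_cutoff\<close>; the normalising
  factor is restored in \<open>fourier_state\<close>.\<close>

definition fourier_integral :: "('a::euclidean_space \<Rightarrow> complex) \<Rightarrow> 'a \<Rightarrow> complex" where
  "fourier_integral f x = (LINT p|lborel. cis (p \<bullet> x) * f p)"

lemma borel_measurable_fourier_integral [measurable]:
  fixes f :: "'a::euclidean_space \<Rightarrow> complex"
  assumes [measurable]: "f \<in> borel_measurable borel"
  shows "fourier_integral f \<in> borel_measurable borel"
  unfolding fourier_integral_def by measurable

lemma norm_fourier_integral_le:
  fixes f :: "'a::euclidean_space \<Rightarrow> complex"
  shows "norm (fourier_integral f x) \<le> (LINT p|lborel. norm (f p))"
  unfolding fourier_integral_def
  using integral_norm_bound[of lborel "\<lambda>p. cis (p \<bullet> x) * f p"] by (simp add: norm_mult)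

lemma integrable_mult_pair:
  fixes f g :: "_::euclidean_space \<Rightarrow> complex"
  assumes f: "integrable lborel f" and g: "integrable lborel g"
  shows "integrable (lborel \<Otimes>\<^sub>M lborel) (\<lambda>(x, y). f x * g y)"
proof (rule lborel_pair.Fubini_integrable)
  have [measurable]: "f \<in> borel_measurable borel" "g \<in> borel_measurable borel"
    using f g by auto
  show "(\<lambda>(x, y). f x * g y) \<in> borel_measurable (lborel \<Otimes>\<^sub>M lborel)" by measurable
qed (use f g in \<open>simp_all add: norm_mult\<close>)

text \<open>Write the squared modulus as a double integral over two momenta. Integrating over
  \<open>x\<close> first, which the weight permits, leaves a narrow Gaussian in the momentum
  difference; rescaling that difference gives a Gaussian average of autocorrelations of
  \<open>f\<close>.\<close>

lemma fourier_integral_gaussian_weight: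
  fixes f :: "'a::euclidean_space \<Rightarrow> complex"
  assumes f: "integrable lborel f" and "\<epsilon> > 0"
  shows "(LINT x|lborel. fourier_integral f x * cnj (fourier_integral f x) * of_real (gaussian (\<epsilon> *\<^sub>R x)))
    = of_real (sqrt (2 * pi) ^ DIM('a))
      * (LINT h|lborel. of_real (gaussian h) * (LINT q|lborel. f (q + \<epsilon> *\<^sub>R h) * cnj (f q)))"
proof -
  have [measurable]: "f \<in> borel_measurable borel" using f by auto
  have "integrable lborel (\<lambda>x. gaussian (\<epsilon> *\<^sub>R x :: 'a))"
    using integrable_lborel_affine_iff[of \<epsilon> "gaussian :: 'a \<Rightarrow> real" 0] assms(2) integrable_gaussian[where 'a='a]
    by simp
  then have G: "integrable lborel (\<lambda>x. complex_of_real (gaussian (\<epsilon> *\<^sub>R x :: 'a)))" by (rule integrable_of_real)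
  have fc: "integrable lborel (\<lambda>q. cnj (f q))" using f by simp
  let ?K = "\<lambda>u. LINT x|lborel. cis (u \<bullet> x) * complex_of_real (gaussian (\<epsilon> *\<^sub>R x :: 'a))"
  \<comment> \<open>The pair \<open>z = (q, p)\<close> is kept as one variable, so that both
    momentum integrals are exchanged with the \<open>x\<close> integral in a single application of
    Fubini.\<close>
  define F where "F = (\<lambda>z. cnj (f (fst z)) * f (snd z))"
  define P where "P = (\<lambda>x z. cis ((snd z - fst z) \<bullet> x) * of_real (gaussian (\<epsilon> *\<^sub>R x)) * F z)"
  have ff: "integrable (lborel \<Otimes>\<^sub>M lborel) (\<lambda>(q, p). cnj (f q) * f p)"
    using integrable_mult_pair[OF fc f] .
  then have ff': "integrable lborel F"
    by (simp add: lborel_prod case_prod_beta' F_def)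
  have [measurable]: "(\<lambda>(q, p). cnj (f q) * f p) \<in> borel_measurable (lborel \<Otimes>\<^sub>M lborel)"
    by measurable
  then have [measurable]: "F \<in> borel_measurable (lborel \<Otimes>\<^sub>M lborel)"
    by (simp add: F_def case_prod_beta')
  have P_int: "integrable (lborel \<Otimes>\<^sub>M lborel) (case_prod P)"
  proof (rule Bochner_Integration.integrable_bound[OF integrable_mult_pair[OF G ff']])
    show "case_prod P \<in> borel_measurable (lborel \<Otimes>\<^sub>M lborel)"
      unfolding P_def lborel_prod[symmetric] by measurable
  qed (auto simp: P_def norm_mult)
  have "fourier_integral f x * cnj (fourier_integral f x) * of_real (gaussian (\<epsilon> *\<^sub>R x))
      = (LINT z|lborel. P x z)" for x
  proof -
    have "integrable (lborel \<Otimes>\<^sub>M lborel) (\<lambda>(q, p). P x (q, p))"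
    proof (rule Bochner_Integration.integrable_bound[OF ff])
      show "(\<lambda>(q, p). P x (q, p)) \<in> borel_measurable (lborel \<Otimes>\<^sub>M lborel)"
        unfolding P_def by measurable
      show "AE z in lborel \<Otimes>\<^sub>M lborel. norm (case z of (q, p) \<Rightarrow> P x (q, p)) \<le> norm (case z of (q, p) \<Rightarrow> cnj (f q) * f p)"
      proof (rule AE_I2)
        fix z :: "'a \<times> 'a"
        have "norm (P x z) \<le> 1 * (norm (f (fst z)) * norm (f (snd z)))"
          unfolding P_def F_def norm_mult using gaussian_pos[of "\<epsilon> *\<^sub>R x"] gaussian_le_1[of "\<epsilon> *\<^sub>R x"]
          by (intro mult_mono) auto
        then show "norm (case z of (q, p) \<Rightarrow> P x (q, p)) \<le> norm (case z of (q, p) \<Rightarrow> cnj (f q) * f p)"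
          by (simp add: case_prod_beta norm_mult)
      qed
    qed
    then have "(LINT z|(lborel \<Otimes>\<^sub>M lborel). P x z) = (LINT q|lborel. LINT p|lborel. P x (q, p))"
      by (subst lborel_pair.integral_fst) (auto simp: case_prod_beta)
    also have "\<dots> = (LINT q|lborel. fourier_integral f x * cnj (cis (q \<bullet> x) * f q) * of_real (gaussian (\<epsilon> *\<^sub>R x)))"
    proof (intro Bochner_Integration.integral_cong refl)
      fix q
      have "P x (q, p) = (cis (p \<bullet> x) * f p) * (cnj (cis (q \<bullet> x) * f q) * of_real (gaussian (\<epsilon> *\<^sub>R x)))" for p
        by (simp add: P_def F_def inner_diff_left cis_cnj cis_mult[symmetric] flip: cis_divide)
           (simp add: cis_inverse divide_inverse cis_cnj)
      then show "(LINT p|lborel. P x (q, p)) = fourier_integral f x * cnj (cis (q \<bullet> x) * f q) * of_real (gaussian (\<epsilon> *\<^sub>R x))"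
        unfolding fourier_integral_def by (simp only: integral_mult_left_zero) (simp only: mult.assoc)
    qed
    also have "\<dots> = fourier_integral f x * cnj (fourier_integral f x) * of_real (gaussian (\<epsilon> *\<^sub>R x))"
    proof -
      have "cnj (fourier_integral f x) = (LINT q|lborel. cnj (cis (q \<bullet> x) * f q))"
        unfolding fourier_integral_def by (simp only: Bochner_Integration.integral_cnj)
      then show ?thesis by (simp only: integral_mult_left_zero integral_mult_right_zero)
    qed
    finally show ?thesis by (simp add: lborel_prod)
  qed
  then have "(LINT x|lborel. fourier_integral f x * cnj (fourier_integral f x) * of_real (gaussian (\<epsilon> *\<^sub>R x)))
      = (LINT x|lborel. LINT z|lborel. P x z)" by simp
  also have "\<dots> = (LINT z|lborel. LINT x|lborel. P x z)"
    using lborel_pair.Fubini_integral[OF P_int] by simp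
  also have "\<dots> = (LINT z|lborel. ?K (snd z - fst z) * (cnj (f (fst z)) * f (snd z)))"
    unfolding P_def F_def by simp
  also have "\<dots> = (LINT q|lborel. LINT p|lborel. ?K (p - q) * (cnj (f q) * f p))"
  proof -
    \<comment> \<open>The kernel never exceeds the total mass of the weight, so the integrability of
      the product of \<open>f\<close> with its conjugate carries over and the pair integral may be
      iterated.\<close>
    have Kb: "norm (?K u) \<le> (LINT x|lborel. gaussian (\<epsilon> *\<^sub>R x :: 'a))" for u :: 'a
      using integral_norm_bound[of lborel "\<lambda>x. cis (u \<bullet> x) * complex_of_real (gaussian (\<epsilon> *\<^sub>R x :: 'a))"]
      by (simp add: norm_mult less_imp_le[OF gaussian_pos])
    have "integrable (lborel \<Otimes>\<^sub>M lborel) (\<lambda>(q, p). ?K (p - q) * (cnj (f q) * f p))"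
    proof (rule Bochner_Integration.integrable_bound)
      show "integrable (lborel \<Otimes>\<^sub>M lborel) (\<lambda>(q, p). of_real (LINT x|lborel. gaussian (\<epsilon> *\<^sub>R x :: 'a)) * (cnj (f q) * f p))"
        using integrable_mult_right[OF ff, of "of_real (LINT x|lborel. gaussian (\<epsilon> *\<^sub>R x :: 'a))"]
        by (simp add: case_prod_beta')
      show "(\<lambda>(q, p). ?K (p - q) * (cnj (f q) * f p)) \<in> borel_measurable (lborel \<Otimes>\<^sub>M lborel)"
        by measurable
      have "0 \<le> (LINT x|lborel. gaussian (\<epsilon> *\<^sub>R x :: 'a))"
        by (simp add: less_imp_le[OF gaussian_pos])
      then show "AE z in lborel \<Otimes>\<^sub>M lborel. norm (case z of (q, p) \<Rightarrow> ?K (p - q) * (cnj (f q) * f p))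
          \<le> norm (case z of (q, p) \<Rightarrow> of_real (LINT x|lborel. gaussian (\<epsilon> *\<^sub>R x :: 'a)) * (cnj (f q) * f p))"
        using Kb by (intro AE_I2) (auto simp only: norm_mult norm_of_real abs_of_nonneg split: prod.splits intro!: mult_right_mono mult_nonneg_nonneg norm_ge_zero)
    qed
    then show ?thesis
      by (subst lborel_pair.integral_fst) (simp_all add: lborel_prod case_prod_beta')
  qed
  also have "\<dots> = (LINT q|lborel. LINT h|lborel.
      of_real (sqrt (2 * pi) ^ DIM('a) * gaussian h) * (cnj (f q) * f (q + \<epsilon> *\<^sub>R h)))"
  proof (rule Bochner_Integration.integral_cong[OF refl])
    fix q
    have "(LINT p|lborel. ?K (p - q) * (cnj (f q) * f p))
        = \<bar>\<epsilon>\<bar> ^ DIM('a) *\<^sub>R (LINT h|lborel. ?K (q + \<epsilon> *\<^sub>R h - q) * (cnj (f q) * f (q + \<epsilon> *\<^sub>R h)))"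
      by (rule integral_lborel_affine) (use assms in auto)
    also have "\<dots> = (LINT h|lborel. (of_real (\<epsilon> ^ DIM('a)) * ?K (\<epsilon> *\<^sub>R h)) * (cnj (f q) * f (q + \<epsilon> *\<^sub>R h)))"
      using assms(2) by (simp add: scaleR_conv_of_real mult.assoc)
    also have "\<dots> = (LINT h|lborel.
      of_real (sqrt (2 * pi) ^ DIM('a) * gaussian h) * (cnj (f q) * f (q + \<epsilon> *\<^sub>R h)))"
      using gaussian_fourier_scaled[OF assms(2), where 'a='a] by simp
    finally show "(LINT p|lborel. ?K (p - q) * (cnj (f q) * f p)) = (LINT h|lborel.
      of_real (sqrt (2 * pi) ^ DIM('a) * gaussian h) * (cnj (f q) * f (q + \<epsilon> *\<^sub>R h)))" .
  qed
  \<comment> \<open>Interchanging \<open>q\<close> and \<open>h\<close> collects the autocorrelation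
    of \<open>f\<close> at the shift \<open>\<epsilon> *\<^sub>R h\<close>.\<close>
  also have "\<dots> = (LINT h|lborel. LINT q|lborel.
      of_real (sqrt (2 * pi) ^ DIM('a) * gaussian h) * (cnj (f q) * f (q + \<epsilon> *\<^sub>R h)))"
  proof (rule lborel_pair.Fubini_integral[symmetric])
    have sh: "integrable (lborel \<Otimes>\<^sub>M lborel) (\<lambda>(q, h). cnj (f q) * f (q + \<epsilon> *\<^sub>R h))"
    proof (rule lborel_pair.Fubini_integrable)
      have "integrable lborel (\<lambda>h. f (q + \<epsilon> *\<^sub>R h))" for q
        using integrable_lborel_affine_iff[of \<epsilon> f q] assms by simp
      then show "AE q in lborel. integrable lborel (\<lambda>h. case (q, h) of (q, h) \<Rightarrow> cnj (f q) * f (q + \<epsilon> *\<^sub>R h))"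
        by simp
      have "(LINT h|lborel. norm (f (q + \<epsilon> *\<^sub>R h))) = (LINT h|lborel. norm (f h)) / \<epsilon> ^ DIM('a)" for q
        using integral_lborel_affine[of \<epsilon> "\<lambda>x. norm (f x)" q] assms(2) by simp
      then show "integrable lborel (\<lambda>q. LINT h|lborel. norm (case (q, h) of (q, h) \<Rightarrow> cnj (f q) * f (q + \<epsilon> *\<^sub>R h)))"
        using f by (simp add: norm_mult)
    qed measurable
    show "integrable (lborel \<Otimes>\<^sub>M lborel) (\<lambda>(q, h). of_real (sqrt (2 * pi) ^ DIM('a) * gaussian h) * (cnj (f q) * f (q + \<epsilon> *\<^sub>R h)))"
    proof (rule Bochner_Integration.integrable_bound)
      show "integrable (lborel \<Otimes>\<^sub>M lborel) (\<lambda>(q, h). of_real (sqrt (2 * pi) ^ DIM('a)) * (cnj (f q) * f (q + \<epsilon> *\<^sub>R h)))"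
        using integrable_mult_right[OF sh, of "of_real (sqrt (2 * pi) ^ DIM('a))"]
        by (simp add: case_prod_beta')
      have "norm (of_real (sqrt (2 * pi) ^ DIM('a) * gaussian h) * (cnj (f q) * f (q + \<epsilon> *\<^sub>R h)))
          \<le> norm (of_real (sqrt (2 * pi) ^ DIM('a)) * (cnj (f q) * f (q + \<epsilon> *\<^sub>R h)))" for q h
      proof -
        have "\<bar>sqrt (2 * pi) ^ DIM('a) * gaussian h\<bar> \<le> \<bar>sqrt (2 * pi) ^ DIM('a)\<bar>"
          using gaussian_le_1[of h] gaussian_pos[of h] by (simp add: abs_mult mult_le_cancel_left1)
        then show ?thesis unfolding norm_mult norm_of_real by (intro mult_right_mono) auto
      qed
      then show "AE z in lborel \<Otimes>\<^sub>M lborel.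
          norm (case z of (q, h) \<Rightarrow> of_real (sqrt (2 * pi) ^ DIM('a) * gaussian h) * (cnj (f q) * f (q + \<epsilon> *\<^sub>R h)))
          \<le> norm (case z of (q, h) \<Rightarrow> of_real (sqrt (2 * pi) ^ DIM('a)) * (cnj (f q) * f (q + \<epsilon> *\<^sub>R h)))"
        by (auto simp only: split: prod.splits)
    qed measurable
  qed
  also have "\<dots> = of_real (sqrt (2 * pi) ^ DIM('a))
      * (LINT h|lborel. of_real (gaussian h) * (LINT q|lborel. f (q + \<epsilon> *\<^sub>R h) * cnj (f q)))"
    by (simp add: mult.assoc mult.commute[of "cnj _"])
  finally show ?thesis .
qed

text \<open>Let the weight widen. On the frequency side monotone convergence yields integrability
  and value together; on the other side the autocorrelation tends to the squared norm of
  \<open>f\<close>, under a fixed Gaussian, by translation continuity.\<close>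

lemma plancherel_scalar:
  fixes f :: "'a::euclidean_space \<Rightarrow> complex"
  assumes f: "integrable lborel f" and sq: "square_integrable f" and tc: "translation_continuous f"
  shows "integrable lborel (\<lambda>x. (norm (fourier_integral f x))\<^sup>2)" (is ?int)
    and "(LINT x|lborel. (norm (fourier_integral f x))\<^sup>2) = (2 * pi) ^ DIM('a) * (LINT p|lborel. (norm (f p))\<^sup>2)" (is ?eq)
proof -
  have [measurable]: "f \<in> borel_measurable borel" using sq by (simp add: square_integrable_def)
  define c where "c = sqrt (2 * pi) ^ DIM('a)"
  define \<epsilon> where "\<epsilon> = (\<lambda>n. inverse (real (Suc n)))"
  have eps: "\<epsilon> n > 0" "\<epsilon> n \<le> 1" for n by (auto simp: \<epsilon>_def divide_simps)
  have eps_lim: "\<epsilon> \<longlonglongrightarrow> 0" unfolding \<epsilon>_def by (rule LIMSEQ_inverse_real_of_nat)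
  define S where "S = (LINT p|lborel. (norm (f p))\<^sup>2)"
  define T where "T = (\<lambda>y. LINT q|lborel. f (q + y) * cnj (f q))"
  define D where "D = (\<lambda>y. LINT q|lborel. (norm (f (q + y) - f q))\<^sup>2)"
  note sqi = square_integrable_integrable[OF sq]
  note shift = square_integrable_translate[OF sq]
  note transi = square_integrable_integrable[OF shift]
  have S_trans: "(LINT q|lborel. (norm (f (q + y)))\<^sup>2) = S" for y
    unfolding S_def by (rule integral_lborel_translate) measurable
  have Ti: "integrable lborel (\<lambda>q. f (q + y) * cnj (f q))" for y
  proof (rule Bochner_Integration.integrable_bound)
    show "integrable lborel (\<lambda>q. (norm (f (q + y)))\<^sup>2 + (norm (f q))\<^sup>2)"
      using transi sqi by simp
    show "AE q in lborel. norm (f (q + y) * cnj (f q)) \<le> norm ((norm (f (q + y)))\<^sup>2 + (norm (f q))\<^sup>2)"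
    proof (rule AE_I2)
      fix q
      have "2 * (norm (f (q + y)) * norm (f q)) \<le> (norm (f (q + y)))\<^sup>2 + (norm (f q))\<^sup>2"
        using sum_squares_bound[of "norm (f (q + y))" "norm (f q)"] by (simp add: mult.assoc)
      moreover have "0 \<le> norm (f (q + y)) * norm (f q)" by simp
      ultimately show "norm (f (q + y) * cnj (f q)) \<le> norm ((norm (f (q + y)))\<^sup>2 + (norm (f q))\<^sup>2)"
        unfolding norm_mult complex_mod_cnj real_norm_def abs_of_nonneg[OF add_nonneg_nonneg[OF zero_le_power2 zero_le_power2]]
        by linarith
    qed
  qed measurable
  \<comment> \<open>Polarization. \<open>D\<close> is the mean-square change of \<open>f\<close>
    under the shift, so translation continuity says that the real part of \<open>T\<close> tends to
    \<open>S\<close>.\<close>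
  have ReT: "Re (T y) = S - D y / 2" for y
  proof -
    have "Re (T y) = (LINT q|lborel. Re (f (q + y) * cnj (f q)))"
      unfolding T_def using Ti[of y] by (simp only: integral_Re)
    also have "\<dots> = (LINT q|lborel. ((norm (f (q + y)))\<^sup>2 + (norm (f q))\<^sup>2 - (norm (f (q + y) - f q))\<^sup>2) / 2)"
      unfolding cmod_power2
      by (intro Bochner_Integration.integral_cong refl) (simp add: algebra_simps power2_eq_square)
    also have "\<dots> = (S + S - D y) / 2"
      using transi[of y] sqi square_integrable_integrable[OF square_integrable_diff[OF shift[of y] sq]]
      by (simp add: S_trans D_def) (simp add: S_def)
    finally show ?thesis by simp
  qed
  have D0: "0 \<le> D y" for y unfolding D_def by simp
  \<comment> \<open>Together with \<open>ReT\<close> and \<open>D0\<close> this confines the real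
    part of \<open>T\<close> to the interval from \<open>- S\<close> to \<open>S\<close>, which
    provides the domination.\<close>
  have D_bound: "D y \<le> 4 * S" for y
    using integral_norm_add_power2_le[OF shift[of y] square_integrable_uminus[OF sq]]
    by (simp add: S_trans D_def) (simp add: S_def)
  have S0: "0 \<le> S" unfolding S_def by simp
  have [measurable]: "D \<in> borel_measurable borel" unfolding D_def by measurable
  have ReT_bound: "\<bar>Re (T y)\<bar> \<le> S" for y
    using ReT[of y] D0[of y] D_bound[of y] by (simp add: abs_le_iff)
  have [measurable]: "T \<in> borel_measurable borel" unfolding T_def by measurable
  \<comment> \<open>The full modulus is needed as well: the real part is taken inside the complex
    integral only once that integrand is known to be integrable.\<close>
  have T_norm: "norm (T y) \<le> S" for y
  proof -
    have "norm (T y) \<le> (LINT q|lborel. norm (f (q + y) * cnj (f q)))"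
      unfolding T_def by (rule integral_norm_bound)
    also have "\<dots> \<le> (LINT q|lborel. ((norm (f (q + y)))\<^sup>2 + (norm (f q))\<^sup>2) / 2)"
    proof (rule integral_mono)
      show "norm (f (q + y) * cnj (f q)) \<le> ((norm (f (q + y)))\<^sup>2 + (norm (f q))\<^sup>2) / 2" for q
        using sum_squares_bound[of "norm (f (q + y))" "norm (f q)"] by (simp add: norm_mult mult.assoc)
    qed (use Ti[of y] transi[of y] sqi in auto)
    also have "\<dots> = S" using transi[of y] sqi by (simp add: S_trans) (simp add: S_def)
    finally show ?thesis .
  qed
  let ?F = "\<lambda>x. (norm (fourier_integral f x))\<^sup>2"
  have weighted: "(LINT x|lborel. ?F x * gaussian (\<epsilon> n *\<^sub>R x))
      = c * (LINT h|lborel. gaussian h * Re (T (\<epsilon> n *\<^sub>R h)))" for n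
  proof -
    have "complex_of_real (LINT x|lborel. ?F x * gaussian (\<epsilon> n *\<^sub>R x))
        = (LINT x|lborel. fourier_integral f x * cnj (fourier_integral f x) * of_real (gaussian (\<epsilon> n *\<^sub>R x)))"
      by (simp only: integral_complex_of_real[symmetric] of_real_mult complex_norm_square)
    also have "\<dots> = of_real c * (LINT h|lborel. of_real (gaussian h) * T (\<epsilon> n *\<^sub>R h))"
      unfolding T_def c_def by (rule fourier_integral_gaussian_weight[OF f eps(1)])
    finally have "(LINT x|lborel. ?F x * gaussian (\<epsilon> n *\<^sub>R x))
        = Re (of_real c * (LINT h|lborel. of_real (gaussian h) * T (\<epsilon> n *\<^sub>R h)))"
      by (metis Re_complex_of_real)
    also have "\<dots> = c * Re (LINT h|lborel. of_real (gaussian h) * T (\<epsilon> n *\<^sub>R h))" by simp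
    also have "Re (LINT h|lborel. of_real (gaussian h) * T (\<epsilon> n *\<^sub>R h))
        = (LINT h|lborel. Re (of_real (gaussian h) * T (\<epsilon> n *\<^sub>R h)))"
    proof (rule integral_Re[symmetric], rule Bochner_Integration.integrable_bound)
      show "integrable lborel (\<lambda>h::'a. S * gaussian h)" by (intro integrable_mult_right integrable_gaussian)
      show "AE h in lborel. norm (of_real (gaussian h) * T (\<epsilon> n *\<^sub>R h)) \<le> norm (S * gaussian h)"
        using T_norm S0 gaussian_pos by (auto simp: norm_mult abs_mult mult.commute[of S] less_imp_le intro!: mult_left_mono)
    qed measurable
    finally show ?thesis by simp
  qed
  have "(\<lambda>n. LINT h|lborel. gaussian h * Re (T (\<epsilon> n *\<^sub>R h))) \<longlonglongrightarrow> (LINT h|lborel. gaussian (h::'a) * S)"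
  proof (rule integral_dominated_convergence)
    show "integrable lborel (\<lambda>h::'a. gaussian h * S)" by (intro integrable_mult_left integrable_gaussian)
    show "AE h in lborel. (\<lambda>n. gaussian h * Re (T (\<epsilon> n *\<^sub>R h))) \<longlonglongrightarrow> gaussian h * S"
    proof (intro AE_I2 tendsto_intros)
      fix h :: 'a
      have "(\<lambda>n. \<epsilon> n *\<^sub>R h) \<longlonglongrightarrow> 0 *\<^sub>R h" by (intro tendsto_intros eps_lim)
      then have "(\<lambda>n. \<epsilon> n *\<^sub>R h) \<longlonglongrightarrow> 0" by simp
      then have "(\<lambda>n. D (\<epsilon> n *\<^sub>R h)) \<longlonglongrightarrow> 0"
        using tc unfolding translation_continuous_def D_def by blast
      then have "(\<lambda>n. S - D (\<epsilon> n *\<^sub>R h) / 2) \<longlonglongrightarrow> S - 0 / 2" by (intro tendsto_intros) auto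
      then show "(\<lambda>n. Re (T (\<epsilon> n *\<^sub>R h))) \<longlonglongrightarrow> S" by (simp add: ReT)
    qed
    show "AE h in lborel. norm (gaussian h * Re (T (\<epsilon> n *\<^sub>R h))) \<le> gaussian h * S" for n
    proof (rule AE_I2)
      fix h :: 'a
      have "norm (gaussian h * Re (T (\<epsilon> n *\<^sub>R h))) = gaussian h * \<bar>Re (T (\<epsilon> n *\<^sub>R h))\<bar>"
        using gaussian_pos[of h] by (simp add: abs_mult)
      also have "\<dots> \<le> gaussian h * S"
        by (intro mult_left_mono ReT_bound less_imp_le[OF gaussian_pos])
      finally show "norm (gaussian h * Re (T (\<epsilon> n *\<^sub>R h))) \<le> gaussian h * S" .
    qed
  qed measurable
  then have "(\<lambda>n. LINT x|lborel. ?F x * gaussian (\<epsilon> n *\<^sub>R x)) \<longlonglongrightarrow> c * (c * S)"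
    unfolding weighted by (intro tendsto_intros) (simp add: integral_gaussian c_def)
  \<comment> \<open>One factor \<open>c\<close> is the constant of the Gaussian transform, the other
    the total mass of the Gaussian in \<open>h\<close>.\<close>
  moreover have "c * (c * S) = (2 * pi) ^ DIM('a) * S"
  proof -
    have "c * c = (sqrt (2 * pi) * sqrt (2 * pi)) ^ DIM('a)"
      unfolding c_def by (rule power_mult_distrib[symmetric])
    also have "sqrt (2 * pi) * sqrt (2 * pi) = 2 * pi" by simp
    finally show ?thesis by (simp only: mult.assoc[symmetric])
  qed
  ultimately have L: "(\<lambda>n. LINT x|lborel. ?F x * gaussian (\<epsilon> n *\<^sub>R x)) \<longlonglongrightarrow> (2 * pi) ^ DIM('a) * S" by simp
  have "has_bochner_integral lborel ?F ((2 * pi) ^ DIM('a) * S)"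
  proof (rule has_bochner_integral_monotone_convergence[OF _ _ _ L])
    show "integrable lborel (\<lambda>x. ?F x * gaussian (\<epsilon> n *\<^sub>R x))" for n
    proof (rule Bochner_Integration.integrable_bound)
      let ?B = "(LINT p|lborel. norm (f p))\<^sup>2"
      have "integrable lborel (\<lambda>x::'a. gaussian (\<epsilon> n *\<^sub>R x))"
        using integrable_lborel_affine_iff[of "\<epsilon> n" "gaussian :: 'a \<Rightarrow> real" 0] eps(1)[of n] integrable_gaussian[where 'a='a]
        by simp
      then show "integrable lborel (\<lambda>x::'a. ?B * gaussian (\<epsilon> n *\<^sub>R x))" by simp
      show "AE x in lborel. norm (?F x * gaussian (\<epsilon> n *\<^sub>R x)) \<le> norm (?B * gaussian (\<epsilon> n *\<^sub>R x))"
      proof (rule AE_I2)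
        fix x
        have "?F x \<le> ?B" by (intro power_mono norm_fourier_integral_le) simp
        then show "norm (?F x * gaussian (\<epsilon> n *\<^sub>R x)) \<le> norm (?B * gaussian (\<epsilon> n *\<^sub>R x))"
          unfolding norm_mult by (intro mult_right_mono) auto
      qed
    qed measurable
    show "AE x in lborel. mono (\<lambda>n. ?F x * gaussian (\<epsilon> n *\<^sub>R x))"
    proof (intro AE_I2 monoI mult_left_mono)
      fix x :: 'a and m n :: nat assume "m \<le> n"
      then have "\<epsilon> n \<le> \<epsilon> m" unfolding \<epsilon>_def by (intro le_imp_inverse_le) auto
      then have "(norm (\<epsilon> n *\<^sub>R x))\<^sup>2 \<le> (norm (\<epsilon> m *\<^sub>R x))\<^sup>2"
        using eps(1) by (intro power_mono) (auto intro!: mult_right_mono simp: less_imp_le)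
      then show "gaussian (\<epsilon> m *\<^sub>R x) \<le> gaussian (\<epsilon> n *\<^sub>R x)" by (simp add: gaussian_def)
    qed simp
    show "AE x in lborel. (\<lambda>n. ?F x * gaussian (\<epsilon> n *\<^sub>R x)) \<longlonglongrightarrow> ?F x"
    proof (rule AE_I2)
      fix x :: 'a
      have "(\<lambda>n. ?F x * exp (- (norm (\<epsilon> n *\<^sub>R x))\<^sup>2 / 2)) \<longlonglongrightarrow> ?F x * exp (- (norm (0 *\<^sub>R x))\<^sup>2 / 2)"
        by (intro tendsto_intros eps_lim) simp
      then show "(\<lambda>n. ?F x * gaussian (\<epsilon> n *\<^sub>R x)) \<longlonglongrightarrow> ?F x" by (simp add: gaussian_def)
    qed
  qed measurable
  then show ?int ?eq by (auto simp: has_bochner_integral_iff S_def)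
qed

section \<open>The Banach algebra of endomorphisms\<close>

text \<open>On this copy of the bounded operators composition becomes ring multiplication, so that
  \<open>exp\<close>, powers and limits come from the type classes, with the operator norm.\<close>

typedef (overloaded) 'a endo = "UNIV :: ('a::real_normed_vector \<Rightarrow>\<^sub>L 'a) set"
  morphisms endo_blinfun Endo ..

setup_lifting type_definition_endo

text \<open>\<open>perfect_space\<close> excludes the zero space, on which the identity would have
  norm 0 instead of 1.\<close>

instantiation endo :: ("{real_normed_vector, perfect_space}") real_normed_algebra_1
begin

lift_definition zero_endo :: "'a endo" is 0 .
lift_definition one_endo :: "'a endo" is id_blinfun .
lift_definition plus_endo :: "'a endo \<Rightarrow> 'a endo \<Rightarrow> 'a endo" is "(+)" .
lift_definition minus_endo :: "'a endo \<Rightarrow> 'a endo \<Rightarrow> 'a endo" is "(-)" .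
lift_definition uminus_endo :: "'a endo \<Rightarrow> 'a endo" is uminus .
lift_definition times_endo :: "'a endo \<Rightarrow> 'a endo \<Rightarrow> 'a endo" is "(o\<^sub>L)" .
lift_definition scaleR_endo :: "real \<Rightarrow> 'a endo \<Rightarrow> 'a endo" is scaleR .
lift_definition norm_endo :: "'a endo \<Rightarrow> real" is norm .

definition dist_endo :: "'a endo \<Rightarrow> 'a endo \<Rightarrow> real" where
  "dist_endo X Y = norm (X - Y)"
definition sgn_endo :: "'a endo \<Rightarrow> 'a endo" where
  "sgn_endo X = inverse (norm X) *\<^sub>R X"
definition uniformity_endo :: "('a endo \<times> 'a endo) filter" where
  "uniformity_endo = (INF e\<in>{0 <..}. principal {(x, y). dist x y < e})"
definition open_endo :: "'a endo set \<Rightarrow> bool" where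
  "open_endo U = (\<forall>x\<in>U. \<forall>\<^sub>F (x', y) in uniformity. x' = x \<longrightarrow> y \<in> U)"

instance
proof
  fix X Y Z :: "'a endo" and r s :: real
  show "dist X Y = norm (X - Y)" by (simp add: dist_endo_def)
  show "sgn X = scaleR (inverse (norm X)) X" by (simp add: sgn_endo_def)
  show "uniformity = (INF e\<in>{0 <..}. principal {(x, y). dist (x::'a endo) y < e})"
    by (simp add: uniformity_endo_def)
  show "open U = (\<forall>x\<in>U. \<forall>\<^sub>F (x', y) in uniformity. x' = x \<longrightarrow> y \<in> U)" for U :: "'a endo set"
    by (simp add: open_endo_def)
  show "X + Y + Z = X + (Y + Z)" by transfer simp
  show "X + Y = Y + X" by transfer simp
  show "0 + X = X" by transfer simp
  show "- X + X = 0" by transfer simp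
  show "X - Y = X + - Y" by transfer simp
  show "r *\<^sub>R (X + Y) = r *\<^sub>R X + r *\<^sub>R Y" by transfer (simp add: scaleR_add_right)
  show "(r + s) *\<^sub>R X = r *\<^sub>R X + s *\<^sub>R X" by transfer (simp add: scaleR_add_left)
  show "r *\<^sub>R s *\<^sub>R X = (r * s) *\<^sub>R X" by transfer simp
  show "1 *\<^sub>R X = X" by transfer simp
  show "(norm X = 0) = (X = 0)" by transfer simp
  show "norm (X + Y) \<le> norm X + norm Y" by transfer (rule norm_triangle_ineq)
  show "norm (r *\<^sub>R X) = \<bar>r\<bar> * norm X" by transfer simp
  show "X * Y * Z = X * (Y * Z)" by transfer (auto intro!: blinfun_eqI)
  show "(X + Y) * Z = X * Z + Y * Z" by transfer (auto intro!: blinfun_eqI simp: blinfun.bilinear_simps)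
  show "X * (Y + Z) = X * Y + X * Z" by transfer (auto intro!: blinfun_eqI simp: blinfun.bilinear_simps)
  show "(r *\<^sub>R X) * Y = r *\<^sub>R (X * Y)" by transfer (auto intro!: blinfun_eqI simp: blinfun.bilinear_simps)
  show "X * (r *\<^sub>R Y) = r *\<^sub>R (X * Y)" by transfer (auto intro!: blinfun_eqI simp: blinfun.bilinear_simps)
  show "1 * X = X" by transfer (auto intro!: blinfun_eqI)
  show "X * 1 = X" by transfer (auto intro!: blinfun_eqI)
  show "norm (X * Y) \<le> norm X * norm Y" by transfer (rule norm_blinfun_compose)
  show "norm (1 :: 'a endo) = 1" by transfer simp
  show "(0 :: 'a endo) \<noteq> 1"
  proof transfer
    have "norm (id_blinfun :: 'a \<Rightarrow>\<^sub>L 'a) = 1" by simp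
    then show "(0 :: 'a \<Rightarrow>\<^sub>L 'a) \<noteq> id_blinfun" by (metis norm_zero zero_neq_one)
  qed
qed

end

instance endo :: ("{banach, perfect_space}") banach
proof
  fix X :: "nat \<Rightarrow> 'a endo" assume "Cauchy X"
  then have "Cauchy (\<lambda>n. endo_blinfun (X n))"
    unfolding Cauchy_def dist_norm norm_endo.rep_eq minus_endo.rep_eq .
  then obtain L where "(\<lambda>n. endo_blinfun (X n)) \<longlonglongrightarrow> L"
    using Cauchy_convergent convergent_def by blast
  then have "X \<longlonglongrightarrow> Endo L"
    unfolding LIMSEQ_iff norm_endo.rep_eq minus_endo.rep_eq by (simp add: Endo_inverse)
  then show "convergent X" by (auto simp: convergent_def)
qed

definition app :: "'a::real_normed_vector endo \<Rightarrow> 'a \<Rightarrow> 'a" where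
  "app X = blinfun_apply (endo_blinfun X)"

lemma app_simps:
  "app (X + Y) v = app X v + app Y v" "app (X - Y) v = app X v - app Y v"
  "app (r *\<^sub>R X) v = r *\<^sub>R app X v" "app (X * Y) v = app X (app Y v)"
  "app 1 v = v" "app 0 v = 0" "app X 0 = 0"
  for X Y :: "'a::{real_normed_vector, perfect_space} endo"
  unfolding app_def plus_endo.rep_eq minus_endo.rep_eq scaleR_endo.rep_eq times_endo.rep_eq
    one_endo.rep_eq zero_endo.rep_eq
  by (simp_all add: blinfun.bilinear_simps)

lemma app_sum: "app (\<Sum>i\<in>I. X i) v = (\<Sum>i\<in>I. app (X i) v)"
  for X :: "_ \<Rightarrow> 'a::{real_normed_vector, perfect_space} endo"
  by (induction I rule: infinite_finite_induct) (simp_all add: app_simps)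

lemma norm_app_le: "norm (app X v) \<le> norm X * norm v"
  for X :: "'a::{real_normed_vector, perfect_space} endo"
  unfolding app_def norm_endo.rep_eq by (rule norm_blinfun)

lemma norm_endo_bound:
  fixes X :: "'a::{real_normed_vector, perfect_space} endo"
  assumes "0 \<le> b" "\<And>v. norm (app X v) \<le> b * norm v"
  shows "norm X \<le> b"
  unfolding norm_endo.rep_eq using assms by (intro norm_blinfun_bound) (auto simp: app_def)

lemma endo_eqI: "(\<And>v. app X v = app Y v) \<Longrightarrow> X = Y"
  by (metis app_def blinfun_eqI endo_blinfun_inject)

lemma bounded_linear_app_left: "bounded_linear (\<lambda>X. app X v)"
  for v :: "'a::{real_normed_vector, perfect_space}"
  by (rule bounded_linear_intro[where K = "norm v"]) (simp_all add: app_simps norm_app_le)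

definition endo_of :: "('a::real_normed_vector \<Rightarrow> 'a) \<Rightarrow> 'a endo" where
  "endo_of f = Endo (Blinfun f)"

lemma app_endo_of: "bounded_linear f \<Longrightarrow> app (endo_of f) v = f v"
  by (simp add: app_def endo_of_def Endo_inverse bounded_linear_Blinfun_apply)

text \<open>The norm of the matrix type is Euclidean in the entries; passing to \<open>endo\<close>
  replaces it by the operator norm, the one that bounds Fourier multipliers.\<close>

definition mat_endo :: "complex ^ 'c ^ 'c \<Rightarrow> (complex ^ 'c::finite) endo" where
  "mat_endo A = endo_of ((*v) A)"

lemma app_mat_endo [simp]: "app (mat_endo A) v = A *v v"
  unfolding mat_endo_def by (rule app_endo_of) simp

lemma mat_endo_mult: "mat_endo (A ** B) = mat_endo A * mat_endo B"
  by (rule endo_eqI) (simp add: app_simps matrix_vector_mul_assoc)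

lemma mat_endo_one: "mat_endo (mat 1) = 1"
  by (rule endo_eqI) (simp add: app_simps)

lemma mat_vector_mul: "mat z *v v = z *s (v :: complex ^ 'c::finite)"
  by (simp add: vec_eq_iff matrix_vector_mult_def mat_def if_distrib if_distribR sum.delta cong: if_cong)

lemma bounded_linear_mat_endo: "bounded_linear mat_endo"
proof -
  have "linear (mat_endo :: complex ^ 'c ^ 'c \<Rightarrow> (complex ^ 'c) endo)"
    by (rule linearI; rule endo_eqI)
      (simp_all add: app_simps vec_eq_iff matrix_vector_mult_def scaleR_sum_right distrib_right sum.distrib)
  then show ?thesis by (simp add: linear_conv_bounded_linear)
qed

lemma matrix_power_endo: "mat_endo ((((**) A) ^^ k) (mat 1)) = mat_endo A ^ k"
  by (induction k) (simp_all add: mat_endo_one mat_endo_mult)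

text \<open>\<open>matrix_exp\<close> sums in the space of matrices, so summability must be known
  there before the series can be mapped term by term.\<close>

lemma mat_endo_matrix_exp: "mat_endo (matrix_exp A) = exp (mat_endo A)"
  for A :: "complex ^ 'c ^ 'c"
proof -
  \<comment> \<open>A bounded linear left inverse of \<open>mat_endo\<close>; it brings summability
    back from the operator algebra.\<close>
  define entry where "entry = (\<lambda>X :: (complex ^ 'c) endo. \<chi> i j. app X (axis j 1) $ i)"
  have ent: "entry (mat_endo B) = B" for B :: "complex ^ 'c ^ 'c"
    by (simp add: entry_def vec_eq_iff matrix_vector_mult_def axis_def if_distrib cong: if_cong)
  have "bounded_linear entry"
  proof (rule bounded_linear_intro)
    fix X :: "(complex ^ 'c) endo"
    have e: "norm (entry X $ i $ j) \<le> norm X" for i j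
    proof -
      have "norm (app X (axis j 1) $ i) \<le> norm (app X (axis j 1))" by (rule Finite_Cartesian_Product.norm_nth_le)
      also have "\<dots> \<le> norm X * norm (axis j (1::complex) :: complex ^ 'c)" by (rule norm_app_le)
      also have "norm (axis j (1::complex) :: complex ^ 'c) = 1"
        by (simp add: norm_vec_def axis_def L2_set_def if_distrib if_distribR cong: if_cong)
      finally show ?thesis by (simp add: entry_def)
    qed
    have "norm (entry X) \<le> (\<Sum>i\<in>UNIV. norm (entry X $ i))" by (simp add: norm_vec_def L2_set_le_sum)
    also have "\<dots> \<le> (\<Sum>i\<in>UNIV. \<Sum>j\<in>UNIV. norm (entry X $ i $ j))"
      by (intro sum_mono) (simp add: norm_vec_def L2_set_le_sum)
    also have "\<dots> \<le> (\<Sum>i\<in>(UNIV::'c set). \<Sum>j\<in>(UNIV::'c set). norm X)" by (intro sum_mono e)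
    finally show "norm (entry X) \<le> norm X * (real CARD('c) * real CARD('c))" by (simp add: mult_ac)
  qed (simp_all add: entry_def vec_eq_iff app_simps)
  then have "summable (\<lambda>k. entry (mat_endo A ^ k /\<^sub>R fact k))"
    by (rule bounded_linear.summable) (rule summable_exp_generic)
  moreover have entk: "mat_endo A ^ k /\<^sub>R fact k = mat_endo ((1 / fact k) *\<^sub>R (((**) A) ^^ k) (mat 1))" for k
    by (simp add: bounded_linear.linear[OF bounded_linear_mat_endo, THEN linear_cmul] matrix_power_endo divide_inverse)
  ultimately have "summable (\<lambda>k. (1 / fact k) *\<^sub>R (((**) A) ^^ k) (mat 1))"
    by (simp add: ent)
  then have "mat_endo (matrix_exp A) = (\<Sum>k. mat_endo ((1 / fact k) *\<^sub>R (((**) A) ^^ k) (mat 1)))"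
    unfolding matrix_exp_def by (rule bounded_linear.suminf[OF bounded_linear_mat_endo])
  then show ?thesis by (simp add: exp_def entk)
qed

lemma exp_mat_endo_scalar: "exp (mat_endo (mat z)) = (mat_endo (mat (exp z)) :: (complex ^ 'c::finite) endo)"
proof -
  have "linear (\<lambda>z::complex. mat_endo (mat z) :: (complex ^ 'c) endo)"
    by (rule linearI; rule endo_eqI)
      (simp_all add: app_simps mat_vector_mul vec_eq_iff distrib_right)
  then have bl: "bounded_linear (\<lambda>z::complex. mat_endo (mat z) :: (complex ^ 'c) endo)"
    by (simp add: linear_conv_bounded_linear)
  have pow: "mat_endo (mat z) ^ k = (mat_endo (mat (z ^ k)) :: (complex ^ 'c) endo)" for k
  proof (induction k)
    case (Suc k)
    then show ?case
      by (intro endo_eqI) (simp add: app_simps mat_vector_mul vec_eq_iff)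
  qed (simp add: mat_endo_one)
  have "mat_endo (mat (exp z)) = (\<Sum>k. mat_endo (mat (z ^ k /\<^sub>R fact k)) :: (complex ^ 'c) endo)"
    unfolding exp_def by (rule bounded_linear.suminf[OF bl summable_exp_generic])
  also have "\<dots> = exp (mat_endo (mat z))"
    unfolding exp_def pow bl[THEN bounded_linear.linear, THEN linear_cmul] ..
  finally show ?thesis ..
qed

section \<open>Product formula estimates\<close>

context
  fixes X :: "'b::{real_normed_algebra_1, banach}"
begin

text \<open>The tail is dominated by an exponential series since \<open>fact k * fact n\<close> is
  at most \<open>fact (k + n)\<close>. The cases \<open>n = 1\<close> and \<open>n = 2\<close> give
  the one-step errors, general \<open>n\<close> the convergence of \<open>op_exp\<close>.\<close>

lemma norm_exp_minus_partial_sum_le: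
  "norm (exp X - (\<Sum>k<n. X ^ k /\<^sub>R fact k)) \<le> norm X ^ n / fact n * exp (norm X)"
proof -
  let ?f = "\<lambda>k. X ^ k /\<^sub>R fact k"
  have "exp X - (\<Sum>k<n. ?f k) = (\<Sum>k. ?f (k + n))"
    unfolding exp_def using suminf_minus_initial_segment[OF summable_exp_generic[of X], of n] by simp
  also have "norm \<dots> \<le> (\<Sum>k. norm X ^ n / fact n * (norm X ^ k /\<^sub>R fact k))"
  proof (rule norm_suminf_le)
    fix k
    have "fact k * fact n \<le> (fact (k + n) :: nat)"
      by (intro dvd_imp_le fact_fact_dvd_fact) simp
    then have f: "fact k * fact n \<le> (fact (k + n) :: real)"
      by (metis of_nat_fact of_nat_le_iff of_nat_mult)
    have "norm (?f (k + n)) \<le> norm X ^ (k + n) / fact (k + n)"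
      by (simp add: divide_inverse mult.commute mult_left_mono norm_power_ineq)
    also have "\<dots> \<le> norm X ^ (k + n) / (fact k * fact n)"
      by (intro divide_left_mono f) auto
    finally show "norm (?f (k + n)) \<le> norm X ^ n / fact n * (norm X ^ k /\<^sub>R fact k)"
      by (simp add: power_add divide_inverse mult_ac)
  qed (intro summable_mult summable_exp_generic)
  also have "\<dots> = norm X ^ n / fact n * exp (norm X)"
    unfolding exp_def by (rule suminf_mult[OF summable_exp_generic])
  finally show ?thesis .
qed

lemma norm_exp_minus_1_le: "norm (exp X - 1) \<le> norm X * exp (norm X)"
  using norm_exp_minus_partial_sum_le[of 1] by simp

lemma norm_exp_minus_1_minus_le: "norm (exp X - 1 - X) \<le> (norm X)\<^sup>2 * exp (norm X)"
proof -
  have "norm (exp X - 1 - X) \<le> (norm X)\<^sup>2 * exp (norm X) / 2"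
    using norm_exp_minus_partial_sum_le[of 2] by (simp add: numeral_2_eq_2 diff_diff_eq)
  also have "\<dots> \<le> (norm X)\<^sup>2 * exp (norm X)" by simp
  finally show ?thesis .
qed

lemma exp_power_nat: "exp X ^ n = exp (real n *\<^sub>R X)"
proof (induction n)
  case (Suc n)
  have "exp (real (Suc n) *\<^sub>R X) = exp (X + real n *\<^sub>R X)" by (simp add: algebra_simps)
  also have "\<dots> = exp X * exp (real n *\<^sub>R X)" by (rule exp_add_commuting) simp
  finally show ?case by (simp add: Suc)
qed simp

end

text \<open>Telescoping without commutativity, one factor exchanged at a time. Taking
  \<open>r ^ n\<close> instead of the power \<open>n - 1\<close> spares a separate treatment of
  \<open>n = 0\<close> and costs only \<open>1 \<le> r\<close>.\<close>

lemma norm_power_diff_le: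
  fixes U V :: "'b::real_normed_algebra_1"
  assumes "norm U \<le> r" "norm V \<le> r" "1 \<le> r"
  shows "norm (V ^ n - U ^ n) \<le> real n * r ^ n * norm (V - U)"
proof (induction n)
  case (Suc n)
  have Un: "norm (U ^ n) \<le> r ^ n"
    using norm_power_ineq[of U n] power_mono[OF assms(1), of n] by simp
  have "V ^ Suc n - U ^ Suc n = V * (V ^ n - U ^ n) + (V - U) * U ^ n"
    by (simp add: algebra_simps)
  also have "norm \<dots> \<le> norm V * norm (V ^ n - U ^ n) + norm (V - U) * norm (U ^ n)"
    by (intro norm_triangle_mono norm_mult_ineq)
  also have "\<dots> \<le> r * (real n * r ^ n * norm (V - U)) + norm (V - U) * r ^ n"
    using assms Suc Un by (intro add_mono mult_mono) auto
  also have "\<dots> \<le> r * (real n * r ^ n * norm (V - U)) + norm (V - U) * (r * r ^ n)"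
    using assms by (intro add_left_mono mult_left_mono) auto
  also have "\<dots> = real (Suc n) * r ^ Suc n * norm (V - U)"
    by (simp add: algebra_simps)
  finally show ?case .
qed simp

text \<open>\<open>X\<close> will be the mass exponent, \<open>D\<close> the first-order kinetic
  term and \<open>s\<close> the product of spacing and cutoff. Both \<open>exp (X + D)\<close> and
  \<open>exp X * W\<close> are \<open>1 + X + D\<close> to first order, so noncommutativity enters
  only at order \<open>s\<^sup>2\<close>.\<close>

lemma split_step_error:
  fixes X D W :: "'b::{real_normed_algebra_1, banach}"
  assumes "norm X \<le> m * s" "norm D \<le> d * s" "norm (W - 1 - D) \<le> k * s\<^sup>2"
    and "0 \<le> s" "s \<le> 1" "0 \<le> m" "0 \<le> d" "0 \<le> k"
  shows "norm (exp (X + D) - exp X * W)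
    \<le> (m * exp m * (d + k) + m\<^sup>2 * exp m + k + (m + d)\<^sup>2 * exp (m + d)) * s\<^sup>2"
proof -
  have Xm: "norm X \<le> m" using assms mult_left_mono[of s 1 m] by simp
  have XD: "norm (X + D) \<le> (m + d) * s" using norm_triangle_ineq[of X D] assms by (simp add: distrib_right)
  have XDm: "norm (X + D) \<le> m + d" using XD assms mult_left_mono[of s 1 "m + d"] by simp
  have s2: "s\<^sup>2 \<le> s" using assms mult_left_mono[of s 1 s] by (simp add: power2_eq_square)
  have W1: "norm (W - 1) \<le> (d + k) * s"
  proof -
    have "norm (W - 1) \<le> norm (W - 1 - D) + norm D" using norm_triangle_ineq[of "W - 1 - D" D] by simp
    also have "\<dots> \<le> k * s + d * s" using assms mult_left_mono[OF s2, of k] by linarith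
    finally show ?thesis by (simp add: algebra_simps)
  qed
  have E1: "norm (exp X - 1) \<le> (m * s) * exp m"
    by (rule order_trans[OF norm_exp_minus_1_le]) (intro mult_mono, use assms Xm in auto)
  have E2: "norm (exp X - 1 - X) \<le> (m * s)\<^sup>2 * exp m"
    by (rule order_trans[OF norm_exp_minus_1_minus_le]) (intro mult_mono power_mono, use assms Xm in auto)
  have E3: "norm (exp (X + D) - 1 - (X + D)) \<le> ((m + d) * s)\<^sup>2 * exp (m + d)"
    by (rule order_trans[OF norm_exp_minus_1_minus_le]) (intro mult_mono power_mono, use assms XD XDm in auto)
  \<comment> \<open>The first-order terms cancel and every summand on the right is of second order
    in \<open>s\<close>; their bounds are the four summands of the constant.\<close>
  have "exp (X + D) - exp X * W
      = (exp (X + D) - 1 - (X + D)) - (exp X - 1) * (W - 1) - (exp X - 1 - X) - (W - 1 - D)"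
    by (simp add: algebra_simps)
  also have "norm \<dots> \<le> norm (exp (X + D) - 1 - (X + D)) + norm ((exp X - 1) * (W - 1))
      + norm (exp X - 1 - X) + norm (W - 1 - D)"
    by (intro order_trans[OF norm_triangle_ineq4] add_right_mono order_refl)
  also have "\<dots> \<le> ((m + d) * s)\<^sup>2 * exp (m + d) + ((m * s) * exp m) * ((d + k) * s) + (m * s)\<^sup>2 * exp m + k * s\<^sup>2"
    using assms by (intro add_mono E3 E2 order_trans[OF norm_mult_ineq] mult_mono E1 W1) auto
  also have "\<dots> = (m * exp m * (d + k) + m\<^sup>2 * exp m + k + (m + d)\<^sup>2 * exp (m + d)) * s\<^sup>2"
    by (simp add: algebra_simps power2_eq_square)
  finally show ?thesis .
qed

section \<open>States of bounded momentum and Fourier multipliers\<close>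

lemma L2_iff: "\<psi> \<in> L2 \<longleftrightarrow> square_integrable \<psi>"
  by (simp add: L2_def square_integrable_def)

lemma L2_norm_eq: "square_integrable \<psi> \<Longrightarrow> L2_norm \<psi> = ennreal (sqrt (LINT x|lborel. (norm (\<psi> x))\<^sup>2))"
  by (simp add: L2_norm_def L2_iff)

lemma L2_norm_finite_iff: "L2_norm \<psi> < \<infinity> \<longleftrightarrow> square_integrable \<psi>"
  by (simp add: L2_norm_def L2_iff)

text \<open>\<open>op_exp\<close> subtracts partial sums from the limit, \<open>L2_partial\<close>
  the limit from quotients; this brings both under \<open>represents_limit\<close>.\<close>

lemma L2_norm_minus_commute: "L2_norm (\<lambda>x. f x - g x) = L2_norm (\<lambda>x. g x - f x)"
proof -
  have "square_integrable (\<lambda>x. f x - g x) \<longleftrightarrow> square_integrable (\<lambda>x. g x - f x)"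
    using square_integrable_uminus[of "\<lambda>x. f x - g x"] square_integrable_uminus[of "\<lambda>x. g x - f x"] by auto
  then show ?thesis by (simp add: L2_norm_def L2_iff norm_minus_commute)
qed

text \<open>The \<open>f i\<close> may be arbitrary functions: \<open>L2_norm\<close> is infinite
  off \<open>L2\<close>, so a small value already makes the difference square integrable.\<close>

lemma L2_limit_unique:
  fixes g h :: "('d::finite, 'c::finite) state"
  assumes F: "F \<noteq> bot"
    and g: "((\<lambda>i. L2_norm (\<lambda>x. f i x - g x)) \<longlongrightarrow> 0) F"
    and h: "((\<lambda>i. L2_norm (\<lambda>x. f i x - h x)) \<longlongrightarrow> 0) F"
    and S: "square_integrable g" "square_integrable h"
  shows "AE x in lborel. g x = h x"
proof -
  have D: "square_integrable (\<lambda>x. g x - h x)" by (intro square_integrable_diff S)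
  have bound: "(LINT x|lborel. (norm (g x - h x))\<^sup>2) \<le> 4 * e\<^sup>2" if e: "e > 0" for e :: real
  proof -
    have "\<forall>\<^sub>F i in F. L2_norm (\<lambda>x. f i x - g x) < ennreal e \<and> L2_norm (\<lambda>x. f i x - h x) < ennreal e"
      using order_tendstoD(2)[OF g] order_tendstoD(2)[OF h] e by (intro eventually_conj) auto
    then obtain i where i: "L2_norm (\<lambda>x. f i x - g x) < ennreal e" "L2_norm (\<lambda>x. f i x - h x) < ennreal e"
      using eventually_happens F by blast
    have sq: "square_integrable k \<and> (LINT x|lborel. (norm (k x))\<^sup>2) \<le> e\<^sup>2" if "L2_norm k < ennreal e"
      for k :: "('d, 'c) state"
    proof -
      have k: "square_integrable k" 
        using less_trans[OF that ennreal_less_top] unfolding L2_norm_finite_iff[symmetric] infinity_ennreal_def .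
      have "sqrt (LINT x|lborel. (norm (k x))\<^sup>2) < e"
        using that e by (simp add: L2_norm_eq[OF k] ennreal_less_iff)
      then have "sqrt (LINT x|lborel. (norm (k x))\<^sup>2) < sqrt (e\<^sup>2)" using e by simp
      then have "(LINT x|lborel. (norm (k x))\<^sup>2) < e\<^sup>2" by (simp only: real_sqrt_less_iff)
      then show ?thesis using k by simp
    qed
    note s = sq[OF i(1)] sq[OF i(2)]
    have "(LINT x|lborel. (norm (g x - h x))\<^sup>2)
        = (LINT x|lborel. (norm ((f i x - h x) + - (f i x - g x)))\<^sup>2)" by simp
    also have "\<dots> \<le> 2 * (LINT x|lborel. (norm (f i x - h x))\<^sup>2) + 2 * (LINT x|lborel. (norm (- (f i x - g x)))\<^sup>2)"
      by (intro integral_norm_add_power2_le square_integrable_uminus) (use s in auto)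
    also have "\<dots> \<le> 4 * e\<^sup>2"
      using s unfolding norm_minus_cancel by linarith
    finally show ?thesis .
  qed
  have "(LINT x|lborel. (norm (g x - h x))\<^sup>2) \<le> 0"
  proof (rule field_le_epsilon)
    fix e :: real assume "e > 0"
    \<comment> \<open>Half the square root of \<open>e\<close> turns the bound into exactly
      \<open>e\<close>.\<close>
    then show "(LINT x|lborel. (norm (g x - h x))\<^sup>2) \<le> 0 + e" using bound[of "sqrt e / 2"] by (simp add: power_divide)
  qed
  then have "(LINT x|lborel. (norm (g x - h x))\<^sup>2) = 0" by (simp add: antisym)
  then have "AE x in lborel. (norm (g x - h x))\<^sup>2 = 0"
    using square_integrable_integrable[OF D] by (subst (asm) integral_nonneg_eq_0_iff_AE) auto
  then show ?thesis by eventually_elim simp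
qed

lemma bounded_bilinear_vector_scalar_mult:
  "bounded_bilinear ((*s) :: complex \<Rightarrow> complex ^ 'c \<Rightarrow> complex ^ 'c)"
proof
  show "\<exists>K. \<forall>a (b :: complex ^ 'c). norm (a *s b) \<le> norm a * norm b * K"
    by (rule exI[of _ 1]) (simp add: norm_vec_def norm_mult L2_set_right_distrib)
qed (simp_all add: vec_eq_iff algebra_simps)

lemma borel_measurable_vector_scalar_mult [measurable (raw)]:
  fixes g :: "'a \<Rightarrow> complex ^ 'c"
  assumes "f \<in> borel_measurable M" "g \<in> borel_measurable M"
  shows "(\<lambda>x. f x *s g x) \<in> borel_measurable M"
  using assms
  by (rule borel_measurable_continuous_Pair)
    (intro bounded_bilinear.continuous_on[OF bounded_bilinear_vector_scalar_mult] continuous_intros)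

lemma norm_vector_scalar_mult: "norm (a *s (v :: complex ^ 'c)) = norm a * norm v"
  by (simp add: norm_vec_def norm_mult L2_set_right_distrib)

lemma borel_measurable_matrix_vector_mult [measurable (raw)]:
  fixes A :: "complex ^ 'c ^ 'c"
  assumes "g \<in> borel_measurable M"
  shows "(\<lambda>x. A *v g x) \<in> borel_measurable M"
  using measurable_compose[OF assms borel_measurable_continuous_onI[of "(*v) A"]]
  by (simp add: linear_continuous_on)

section \<open>Amplitudes on the momentum cube and Plancherel for coin vectors\<close>

definition amplitude :: "real \<Rightarrow> ('d::finite, 'c::finite) state \<Rightarrow> bool" where
  "amplitude L \<phi> \<longleftrightarrow> square_integrable \<phi> \<and> (\<forall>p. (\<exists>b. \<bar>p $ b\<bar> > L) \<longrightarrow> \<phi> p = 0)"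

definition fourier_state :: "('d::finite, 'c::finite) state \<Rightarrow> ('d, 'c) state" where
  "fourier_state \<phi> x = (2 * pi) powr (- real CARD('d) / 2) *\<^sub>R (LINT p|lborel. cis (p \<bullet> x) *s \<phi> p)"

text \<open>A relation, because a state is determined only up to null sets: it survives replacing
  \<psi> by whatever \<open>SOME\<close> selects among almost everywhere equal functions.\<close>

definition represents :: "real \<Rightarrow> ('d::finite, 'c::finite) state \<Rightarrow> ('d, 'c) state \<Rightarrow> bool" where
  "represents L \<psi> \<phi> \<longleftrightarrow> square_integrable \<psi> \<and> amplitude L \<phi> \<and>
     (AE x in lborel. \<psi> x = fourier_state \<phi> x)"

lemma momentum_cutoff_iff: "\<psi> \<in> momentum_cutoff L \<longleftrightarrow> (\<exists>\<phi>. represents L \<psi> \<phi>)"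
  by (simp add: momentum_cutoff_def represents_def amplitude_def fourier_state_def L2_iff Bex_def conj_assoc)

text \<open>Passes from the cube to a Euclidean ball, the shape of support used for translation
  continuity; the absolute value covers negative cutoffs, whose cube is empty.\<close>

lemma amplitude_zero_outside_ball:
  fixes \<phi> :: "('d::finite, 'c::finite) state"
  assumes "amplitude L \<phi>" "norm p > real CARD('d) * \<bar>L\<bar>"
  shows "\<phi> p = 0"
proof (rule ccontr)
  assume "\<phi> p \<noteq> 0"
  have le: "\<bar>p $ b\<bar> \<le> \<bar>L\<bar>" for b
  proof -
    have "\<not> \<bar>p $ b\<bar> > L" using assms(1) \<open>\<phi> p \<noteq> 0\<close> unfolding amplitude_def by blast
    then show ?thesis by linarith
  qed
  have "norm p \<le> (\<Sum>b\<in>UNIV. \<bar>p $ b\<bar>)" by (rule norm_le_l1_cart)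
  also have "\<dots> \<le> of_nat (card (UNIV :: 'd set)) * \<bar>L\<bar>" by (rule sum_bounded_above) (rule le)
  finally show False using assms(2) by linarith
qed

lemma amplitude_integrable:
  fixes \<phi> :: "('d::finite, 'c::finite) state"
  assumes "amplitude L \<phi>"
  shows "integrable lborel \<phi>"
proof (rule Bochner_Integration.integrable_bound)
  let ?R = "real CARD('d) * \<bar>L\<bar>"
  have sq: "square_integrable \<phi>" using assms by (simp add: amplitude_def)
  then show "integrable lborel (\<lambda>p. (norm (\<phi> p))\<^sup>2 + indicator (cball (0 :: real ^ 'd) ?R) p)"
    by (intro Bochner_Integration.integrable_add integrable_indicator_cball square_integrable_integrable)
  show "\<phi> \<in> borel_measurable lborel" using sq by (simp add: square_integrable_def)
  have "norm (\<phi> p) \<le> (norm (\<phi> p))\<^sup>2 + indicator (cball 0 ?R) p" for p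
  proof (cases "norm p \<le> ?R")
    case True
    \<comment> \<open>With \<open>y = norm (\<phi> p)\<close> the right side is
      \<open>2 * (y\<^sup>2 - y + 1)\<close>, so this says
      \<open>y \<le> y\<^sup>2 + 1\<close>.\<close>
    have "0 \<le> (norm (\<phi> p) - 1)\<^sup>2 + (norm (\<phi> p))\<^sup>2 + 1" by (intro add_nonneg_nonneg) auto
    then show ?thesis using True by (simp add: power2_diff)
  next
    case False
    then show ?thesis using amplitude_zero_outside_ball[OF assms, of p] by simp
  qed
  then show "AE p in lborel. norm (\<phi> p) \<le> norm ((norm (\<phi> p))\<^sup>2 + indicator (cball 0 ?R) p)"
    unfolding real_norm_def by (intro AE_I2) (rule order_trans[OF _ abs_ge_self])
qed

lemma integrable_cis_vector_mult:
  fixes \<phi> :: "('d::finite, 'c::finite) state"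
  assumes "integrable lborel \<phi>"
  shows "integrable lborel (\<lambda>p. cis (p \<bullet> x) *s \<phi> p)"
proof (rule Bochner_Integration.integrable_bound[OF assms])
  have [measurable]: "\<phi> \<in> borel_measurable borel" using assms by auto
  show "(\<lambda>p. cis (p \<bullet> x) *s \<phi> p) \<in> borel_measurable lborel" by measurable
qed (simp add: norm_vector_scalar_mult)

lemma norm_vec_power2: "(norm (v :: complex ^ 'c))\<^sup>2 = (\<Sum>i\<in>UNIV. (norm (v $ i))\<^sup>2)"
  by (simp add: norm_vec_def L2_set_def sum_nonneg)

text \<open>The squared coin norm is a sum over components, each a scalar function of bounded
  support; the prefactor of \<open>fourier_state\<close> cancels the power of 2 pi.\<close>

lemma plancherel:
  fixes \<phi> :: "('d::finite, 'c::finite) state"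
  assumes amp: "amplitude L \<phi>"
  shows square_integrable_fourier_state: "square_integrable (fourier_state \<phi>)"
    and "(LINT x|lborel. (norm (fourier_state \<phi> x))\<^sup>2) = (LINT p|lborel. (norm (\<phi> p))\<^sup>2)"
proof -
  define c where "c = (2 * pi) powr (- real CARD('d) / 2)"
  have c: "c\<^sup>2 * (2 * pi) ^ CARD('d) = 1"
  proof -
    have "c\<^sup>2 = (2 * pi) powr (- real CARD('d))"
      unfolding c_def power2_eq_square powr_add[symmetric] by (rule arg_cong) simp
    moreover have "(2 * pi) ^ CARD('d) = (2 * pi) powr (real CARD('d))" by (simp add: powr_realpow)
    ultimately show ?thesis by (simp add: powr_minus)
  qed
  have sq: "square_integrable \<phi>" using amp by (simp add: amplitude_def)
  note int = amplitude_integrable[OF amp]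
  have [measurable]: "\<phi> \<in> borel_measurable borel" using sq by (simp add: square_integrable_def)
  have [measurable]: "fourier_state \<phi> \<in> borel_measurable borel" unfolding fourier_state_def by measurable
  have comp: "fourier_state \<phi> x $ i = c *\<^sub>R fourier_integral (\<lambda>p. \<phi> p $ i) x" for x i
    unfolding fourier_state_def fourier_integral_def c_def
    using integral_bounded_linear[OF bounded_linear_vec_nth integrable_cis_vector_mult[OF int, of x], of i]
    by simp
  have inti: "integrable lborel (\<lambda>p. \<phi> p $ i)" for i
    by (rule integrable_bounded_linear[OF bounded_linear_vec_nth int])
  have [measurable]: "(\<lambda>p. \<phi> p $ i) \<in> borel_measurable borel" for i using inti[of i] by auto
  have sqi: "square_integrable (\<lambda>p. \<phi> p $ i)" for i
  proof (rule square_integrable_bound)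
    show "integrable lborel (\<lambda>p. (norm (\<phi> p))\<^sup>2)" using sq by (rule square_integrable_integrable)
    show "AE p in lborel. (norm (\<phi> p $ i))\<^sup>2 \<le> (norm (\<phi> p))\<^sup>2"
      by (intro AE_I2 power_mono Finite_Cartesian_Product.norm_nth_le) simp
  qed measurable
  have tci: "translation_continuous (\<lambda>p. \<phi> p $ i)" for i
    by (rule translation_continuous_bounded_support[OF sqi, of "real CARD('d) * \<bar>L\<bar>"])
      (simp add: amplitude_zero_outside_ball[OF amp])
  note pl = plancherel_scalar[OF inti sqi tci]
  have nrm: "(norm (fourier_state \<phi> x))\<^sup>2 = (\<Sum>i\<in>UNIV. c\<^sup>2 * (norm (fourier_integral (\<lambda>p. \<phi> p $ i) x))\<^sup>2)" for x
    unfolding norm_vec_power2 comp by (simp add: norm_mult power_mult_distrib)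
  show "square_integrable (fourier_state \<phi>)"
    unfolding square_integrable_def nrm by (intro conjI Bochner_Integration.integrable_sum integrable_mult_right pl) measurable
  have "(LINT x|lborel. (norm (fourier_state \<phi> x))\<^sup>2)
      = (\<Sum>i\<in>UNIV. c\<^sup>2 * (LINT x|lborel. (norm (fourier_integral (\<lambda>p. \<phi> p $ i) x))\<^sup>2))"
    unfolding nrm by (subst Bochner_Integration.integral_sum) (auto intro!: integrable_mult_right pl)
  also have "\<dots> = (\<Sum>i\<in>UNIV. (LINT p|lborel. (norm (\<phi> p $ i))\<^sup>2))"
    using c by (simp add: pl(2) mult.assoc[symmetric])
  also have "\<dots> = (LINT p|lborel. (norm (\<phi> p))\<^sup>2)"
    unfolding norm_vec_power2 using square_integrable_integrable[OF sqi]
    by (subst Bochner_Integration.integral_sum) auto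
  finally show "(LINT x|lborel. (norm (fourier_state \<phi> x))\<^sup>2) = (LINT p|lborel. (norm (\<phi> p))\<^sup>2)" .
qed

lemma represents_fourier_state: "amplitude L \<phi> \<Longrightarrow> represents L (fourier_state \<phi>) \<phi>"
  by (simp add: represents_def square_integrable_fourier_state)

lemma represents_cong_AE:
  assumes "represents L \<psi> \<phi>" "square_integrable \<psi>'" "AE x in lborel. \<psi>' x = \<psi> x"
  shows "represents L \<psi>' \<phi>"
  using assms unfolding represents_def by auto

text \<open>Carries norm estimates over to amplitudes, where the operators are matrix
  multiplications.\<close>

lemma represents_L2_norm:
  assumes "represents L \<psi> \<phi>"
  shows "L2_norm \<psi> = L2_norm \<phi>"
proof -
  have sq: "square_integrable \<psi>" "square_integrable \<phi>" and amp: "amplitude L \<phi>"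
    and ae: "AE x in lborel. \<psi> x = fourier_state \<phi> x"
    using assms by (auto simp: represents_def amplitude_def)
  have [measurable]: "\<psi> \<in> borel_measurable borel" "fourier_state \<phi> \<in> borel_measurable borel"
    using sq square_integrable_fourier_state[OF amp] by (auto simp: square_integrable_def)
  have "(LINT x|lborel. (norm (\<psi> x))\<^sup>2) = (LINT x|lborel. (norm (fourier_state \<phi> x))\<^sup>2)"
    using ae by (intro integral_cong_AE) (auto elim: eventually_mono)
  then show ?thesis by (simp add: L2_norm_eq sq plancherel(2)[OF amp])
qed

section \<open>Linear operations and translations on represented states\<close>

lemma square_integrable_matrix:
  fixes A :: "complex ^ 'c ^ 'c"
  assumes sq: "square_integrable \<psi>"
  shows "square_integrable (\<lambda>x. A *v \<psi> x)"
proof (rule square_integrable_bound)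
  have [measurable]: "\<psi> \<in> borel_measurable borel" using sq by (simp add: square_integrable_def)
  show "(\<lambda>x. A *v \<psi> x) \<in> borel_measurable borel" by measurable
  show "integrable lborel (\<lambda>x. (norm (mat_endo A))\<^sup>2 * (norm (\<psi> x))\<^sup>2)"
    by (intro integrable_mult_right square_integrable_integrable sq)
  show "AE x in lborel. (norm (A *v \<psi> x))\<^sup>2 \<le> (norm (mat_endo A))\<^sup>2 * (norm (\<psi> x))\<^sup>2"
    using norm_app_le[of "mat_endo A"]
    by (intro AE_I2) (simp add: power_mult_distrib[symmetric] power_mono)
qed

lemma fourier_state_matrix:
  fixes A :: "complex ^ 'c ^ 'c"
  assumes "amplitude L \<phi>"
  shows "fourier_state (\<lambda>p. A *v \<phi> p) x = A *v fourier_state \<phi> x"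
  unfolding fourier_state_def
  using integral_bounded_linear[OF matrix_vector_mul_bounded_linear[of A]
      integrable_cis_vector_mult[OF amplitude_integrable[OF assms], of x]]
  by (simp add: vector_scalar_commute linear_cmul[OF matrix_vector_mul_linear])

lemma represents_matrix:
  fixes A :: "complex ^ 'c ^ 'c"
  assumes "represents L \<psi> \<phi>"
  shows "represents L (\<lambda>x. A *v \<psi> x) (\<lambda>p. A *v \<phi> p)"
proof -
  have "amplitude L \<phi>" using assms by (simp add: represents_def)
  then show ?thesis
    using assms by (auto simp: represents_def amplitude_def fourier_state_matrix square_integrable_matrix
        elim: eventually_mono)
qed

lemma represents_add:
  assumes "represents L \<psi> \<phi>" "represents L \<psi>' \<phi>'"
  shows "represents L (\<lambda>x. \<psi> x + \<psi>' x) (\<lambda>p. \<phi> p + \<phi>' p)"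
proof -
  have amp: "amplitude L \<phi>" "amplitude L \<phi>'" using assms by (auto simp: represents_def)
  have "fourier_state (\<lambda>p. \<phi> p + \<phi>' p) x = fourier_state \<phi> x + fourier_state \<phi>' x" for x
    unfolding fourier_state_def
    using amp[THEN amplitude_integrable, THEN integrable_cis_vector_mult, of x]
    by (simp add: vector_add_ldistrib scaleR_add_right)
  moreover have "amplitude L (\<lambda>p. \<phi> p + \<phi>' p)"
    using amp by (auto simp: amplitude_def square_integrable_add)
  ultimately show ?thesis
    using assms unfolding represents_def by (auto intro: square_integrable_add)
qed

lemma represents_diff:
  assumes "represents L \<psi> \<phi>" "represents L \<psi>' \<phi>'"
  shows "represents L (\<lambda>x. \<psi> x - \<psi>' x) (\<lambda>p. \<phi> p - \<phi>' p)"
proof -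
  have "mat (-1) *v v = - v" for v :: "complex ^ 'b" by (simp add: mat_vector_mul vec_eq_iff)
  then show ?thesis
    using represents_add[OF assms(1) represents_matrix[OF assms(2), of "mat (-1)"]] by simp
qed

lemma represents_scalar:
  assumes "represents L \<psi> \<phi>"
  shows "represents L (\<lambda>x. c *s \<psi> x) (\<lambda>p. c *s \<phi> p)"
  using represents_matrix[OF assms, of "mat c"] by (simp add: mat_vector_mul)

lemma represents_zero: "represents L (\<lambda>x. 0) (\<lambda>p. 0)"
proof -
  have "cis y *s (0 :: complex ^ 'b) = 0" for y by (simp add: vec_eq_iff)
  then show ?thesis
    by (simp add: represents_def amplitude_def square_integrable_def fourier_state_def)
qed

lemma represents_sum:
  assumes "\<And>i. i \<in> I \<Longrightarrow> represents L (\<psi> i) (\<phi> i)"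
  shows "represents L (\<lambda>x. \<Sum>i\<in>I. \<psi> i x) (\<lambda>p. \<Sum>i\<in>I. \<phi> i p)"
  using assms
  by (induction I rule: infinite_finite_induct) (auto intro: represents_zero represents_add)

lemma represents_translate:
  assumes "represents L \<psi> \<phi>"
  shows "represents L (\<lambda>x. \<psi> (x + y)) (\<lambda>p. cis (p \<bullet> y) *s \<phi> p)"
proof -
  have amp: "amplitude L \<phi>" and sq: "square_integrable \<phi>" using assms by (auto simp: represents_def amplitude_def)
  have [measurable]: "\<phi> \<in> borel_measurable borel" using sq by (simp add: square_integrable_def)
  have "fourier_state (\<lambda>p. cis (p \<bullet> y) *s \<phi> p) x = fourier_state \<phi> (x + y)" for x
    unfolding fourier_state_def by (simp add: vector_smult_assoc inner_add_right cis_mult)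
  moreover have "amplitude L (\<lambda>p. cis (p \<bullet> y) *s \<phi> p)"
    using amp by (auto simp: amplitude_def square_integrable_def norm_vector_scalar_mult)
  ultimately show ?thesis
    using assms AE_lborel_translate[of "\<lambda>x. \<psi> x = fourier_state \<phi> x" y]
    unfolding represents_def by (auto intro: square_integrable_translate)
qed

text \<open>The bound is asked only on the cube, since the symbol of a momentum operator is
  unbounded; elsewhere the amplitude vanishes. Measurability is asked of the product with \<phi>
  because for exponentials it comes from a limit of such products.\<close>

lemma amplitude_multiplier:
  fixes \<phi> :: "('d::finite, 'c::finite) state"
  assumes amp: "amplitude L \<phi>" and [measurable]: "(\<lambda>p. S p *v \<phi> p) \<in> borel_measurable borel"
    and bound: "\<And>p. (\<And>b. \<bar>p $ b\<bar> \<le> L) \<Longrightarrow> norm (mat_endo (S p)) \<le> B" and "0 \<le> B"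
  shows "amplitude L (\<lambda>p. S p *v \<phi> p)"
    and "L2_norm (\<lambda>p. S p *v \<phi> p) \<le> ennreal B * L2_norm \<phi>"
proof -
  have sq: "square_integrable \<phi>" using amp by (simp add: amplitude_def)
  note sqi = square_integrable_integrable[OF sq]
  have le: "(norm (S p *v \<phi> p))\<^sup>2 \<le> B\<^sup>2 * (norm (\<phi> p))\<^sup>2" for p
  proof (cases "\<forall>b. \<bar>p $ b\<bar> \<le> L")
    case True
    then have "norm (mat_endo (S p)) * norm (\<phi> p) \<le> B * norm (\<phi> p)"
      by (intro mult_right_mono bound) auto
    then have "norm (S p *v \<phi> p) \<le> B * norm (\<phi> p)"
      using norm_app_le[of "mat_endo (S p)" "\<phi> p"] by simp
    then show ?thesis unfolding power_mult_distrib[symmetric] by (intro power_mono) auto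
  next
    case False
    then have "\<phi> p = 0" using amp by (auto simp: amplitude_def not_le)
    then show ?thesis by simp
  qed
  have S: "square_integrable (\<lambda>p. S p *v \<phi> p)"
    by (rule square_integrable_bound[OF assms(2) integrable_mult_right[OF sqi, of "B\<^sup>2"]]) (simp add: le)
  then show "amplitude L (\<lambda>p. S p *v \<phi> p)" using amp by (simp add: amplitude_def)
  have "(LINT p|lborel. (norm (S p *v \<phi> p))\<^sup>2) \<le> (LINT p|lborel. B\<^sup>2 * (norm (\<phi> p))\<^sup>2)"
    by (intro integral_mono le square_integrable_integrable S integrable_mult_right sqi)
  also have "\<dots> = B\<^sup>2 * (LINT p|lborel. (norm (\<phi> p))\<^sup>2)" by simp
  finally have "sqrt (LINT p|lborel. (norm (S p *v \<phi> p))\<^sup>2) \<le> sqrt (B\<^sup>2 * (LINT p|lborel. (norm (\<phi> p))\<^sup>2))"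
    by (rule real_sqrt_le_mono)
  also have "\<dots> = B * sqrt (LINT p|lborel. (norm (\<phi> p))\<^sup>2)"
    using assms(4) by (simp add: real_sqrt_mult)
  finally show "L2_norm (\<lambda>p. S p *v \<phi> p) \<le> ennreal B * L2_norm \<phi>"
    using assms(4) by (simp add: L2_norm_eq sq S ennreal_mult[symmetric])
qed

lemma mat_endo_inject: "mat_endo A = mat_endo B \<Longrightarrow> A = B"
  by (metis app_mat_endo matrix_eq)

lemma norm_mat_endo_scalar_le: "norm (mat_endo (mat z :: complex ^ 'c ^ 'c)) \<le> norm z"
  by (rule norm_endo_bound) (simp_all add: mat_vector_mul norm_vector_scalar_mult)

lemma scaleR_eq_scalar: "r *\<^sub>R v = complex_of_real r *s (v :: complex ^ 'c)"
  by (simp add: vec_eq_iff scaleR_conv_of_real[where 'a = complex])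

text \<open>This Taylor remainder serves twice: for the difference quotients that define the
  derivative and for the shift phases of the walk.\<close>

lemma norm_cis_minus_1_minus_le: "norm (cis \<theta> - 1 - \<i> * of_real \<theta>) \<le> \<theta>\<^sup>2 / 2"
  using iexp_approx1[of \<theta> 1] by (simp add: cis_conv_exp power2_eq_square diff_diff_eq)

text \<open>The bridge from operator norms of symbols on the cube to L2 bounds on states.\<close>

lemma represents_norm_le:
  fixes \<phi> :: "('d::finite, 'c::finite) state"
  assumes "represents L \<xi> (\<lambda>p. S p *v \<phi> p)" "amplitude L \<phi>"
    and "\<And>p. (\<And>b. \<bar>p $ b\<bar> \<le> L) \<Longrightarrow> norm (mat_endo (S p)) \<le> B" "0 \<le> B"
  shows "L2_norm \<xi> \<le> ennreal B * L2_norm \<phi>"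
proof -
  have "(\<lambda>p. S p *v \<phi> p) \<in> borel_measurable borel"
    using assms(1) by (simp add: represents_def amplitude_def square_integrable_def)
  then show ?thesis
    using amplitude_multiplier(2)[OF assms(2) _ assms(3,4)] represents_L2_norm[OF assms(1)] by simp
qed

lemma tendsto_ennreal_zero_bound:
  fixes N :: "'i \<Rightarrow> ennreal"
  assumes "\<forall>\<^sub>F i in F. N i \<le> ennreal (B i) * C" "\<forall>\<^sub>F i in F. 0 \<le> B i" "C < \<infinity>" "(B \<longlongrightarrow> 0) F"
  shows "(N \<longlongrightarrow> 0) F"
proof -
  obtain c where c: "C = ennreal c" "0 \<le> c" using assms(3) by (cases C) auto
  have "((\<lambda>i. ennreal (B i * c)) \<longlongrightarrow> ennreal (0 * c)) F"
    by (intro tendsto_ennrealI tendsto_intros assms)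
  moreover have "\<forall>\<^sub>F i in F. N i \<le> ennreal (B i * c)"
    using assms(1,2) by eventually_elim (simp add: c ennreal_mult)
  ultimately show ?thesis
    by (intro tendsto_sandwich[of "\<lambda>_. 0" N F "\<lambda>i. ennreal (B i * c)" 0]) auto
qed

lemma represents_L2_norm_finite: "represents L \<psi> \<phi> \<Longrightarrow> L2_norm \<phi> < \<infinity>"
  unfolding L2_norm_finite_iff by (simp add: represents_def amplitude_def)

text \<open>The limit \<open>\<eta>\<^sub>0\<close> shows that a choice exists; uniqueness of L2
  limits forces the chosen function to agree with it almost everywhere.\<close>

lemma represents_limit:
  assumes F: "F \<noteq> bot" and r: "represents L \<eta>\<^sub>0 \<xi>"
    and lim: "((\<lambda>i. L2_norm (\<lambda>x. f i x - \<eta>\<^sub>0 x)) \<longlongrightarrow> 0) F"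
  shows "represents L (SOME \<eta>. \<eta> \<in> L2 \<and> ((\<lambda>i. L2_norm (\<lambda>x. f i x - \<eta> x)) \<longlongrightarrow> 0) F) \<xi>"
    (is "represents L (SOME \<eta>. ?P \<eta>) \<xi>")
proof -
  have sq: "square_integrable \<eta>\<^sub>0" using r by (simp add: represents_def)
  then have "?P \<eta>\<^sub>0" using lim by (simp add: L2_iff)
  then have P: "?P (SOME \<eta>. ?P \<eta>)" by (rule someI[where P = ?P])
  show ?thesis
  proof (rule represents_cong_AE[OF r])
    show S: "square_integrable (SOME \<eta>. ?P \<eta>)" using P by (simp only: L2_iff)
    show "AE x in lborel. (SOME \<eta>. ?P \<eta>) x = \<eta>\<^sub>0 x"
      using P by (intro L2_limit_unique[OF F _ lim S sq]) blast
  qed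
qed

text \<open>Translation by \<open>h\<close> multiplies the amplitude by a phase. On the cube the
  difference quotients of these phases converge uniformly to the derivative factor, with error of
  order \<open>h\<close>, and this becomes the L2 limit that \<open>L2_partial\<close> asks
  for.\<close>

lemma represents_L2_partial:
  fixes \<psi> :: "('d::finite, 'c::finite) state"
  assumes r: "represents L \<psi> \<phi>"
  shows "represents L (L2_partial b \<psi>) (\<lambda>p. (\<i> * of_real (p $ b)) *s \<phi> p)"
proof -
  let ?S = "\<lambda>p. mat (\<i> * of_real (p $ b)) :: complex ^ 'c ^ 'c"
  have amp: "amplitude L \<phi>" using r by (simp add: represents_def)
  then have [measurable]: "\<phi> \<in> borel_measurable borel" by (simp add: amplitude_def square_integrable_def)
  have sq_le: "(p $ b)\<^sup>2 \<le> L\<^sup>2" if "\<And>b. \<bar>p $ b\<bar> \<le> L" for p :: "real ^ 'd"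
    using that[of b] abs_le_square_iff[of "p $ b" L] by simp
  have "amplitude L (\<lambda>p. ?S p *v \<phi> p)"
  proof (rule amplitude_multiplier(1)[OF amp, where B = "\<bar>L\<bar>"])
    have "(\<lambda>p::real ^ 'd. complex_of_real (p $ b)) \<in> borel_measurable borel"
      by (intro borel_measurable_continuous_onI continuous_intros)
    then show "(\<lambda>p. ?S p *v \<phi> p) \<in> borel_measurable borel" unfolding mat_vector_mul by measurable
    fix p :: "real ^ 'd" assume "\<And>b. \<bar>p $ b\<bar> \<le> L"
    from this[of b] show "norm (mat_endo (?S p)) \<le> \<bar>L\<bar>"
      by (intro order_trans[OF norm_mat_endo_scalar_le]) (simp add: norm_mult)
  qed simp
  then have r0: "represents L (fourier_state (\<lambda>p. ?S p *v \<phi> p)) (\<lambda>p. ?S p *v \<phi> p)"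
    by (rule represents_fourier_state)
  let ?D = "\<lambda>h x. (1 / h) *\<^sub>R (\<psi> (x + h *\<^sub>R axis b 1) - \<psi> x) - fourier_state (\<lambda>p. ?S p *v \<phi> p) x"
  let ?Q = "\<lambda>h p. mat (of_real (1 / h) * (cis (h * p $ b) - 1) - \<i> * of_real (p $ b)) :: complex ^ 'c ^ 'c"
  have bound: "L2_norm (?D h) \<le> ennreal (\<bar>h\<bar> * (L\<^sup>2 / 2)) * L2_norm \<phi>" if "h \<noteq> 0" for h
  proof (rule represents_norm_le[OF _ amp])
    have "represents L (?D h) (\<lambda>p. of_real (1 / h) *s (cis (p \<bullet> (h *\<^sub>R axis b 1)) *s \<phi> p - \<phi> p) - ?S p *v \<phi> p)"
      unfolding scaleR_eq_scalar[of "1 / h"]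
      by (intro represents_diff represents_scalar represents_translate r r0)
    moreover have "of_real (1 / h) *s (cis (p \<bullet> (h *\<^sub>R axis b 1)) *s \<phi> p - \<phi> p) - ?S p *v \<phi> p = ?Q h p *v \<phi> p" for p
      by (simp add: mat_vector_mul vec_eq_iff inner_axis algebra_simps)
    ultimately show "represents L (?D h) (\<lambda>p. ?Q h p *v \<phi> p)" by simp
    fix p :: "real ^ 'd" assume p: "\<And>b. \<bar>p $ b\<bar> \<le> L"
    have "of_real (1 / h) * (cis (h * p $ b) - 1) - \<i> * of_real (p $ b)
        = of_real (1 / h) * (cis (h * p $ b) - 1 - \<i> * of_real (h * p $ b))"
      using that by (simp add: field_simps)
    also have "norm \<dots> \<le> \<bar>1 / h\<bar> * ((h * p $ b)\<^sup>2 / 2)"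
      unfolding norm_mult norm_of_real by (intro mult_left_mono norm_cis_minus_1_minus_le) simp
    also have "\<dots> = \<bar>h\<bar> * ((p $ b)\<^sup>2 / 2)"
      using that by (cases "h > 0") (simp_all add: power2_eq_square)
    also have "\<dots> \<le> \<bar>h\<bar> * (L\<^sup>2 / 2)"
      using sq_le[OF p] by (intro mult_left_mono) auto
    finally show "norm (mat_endo (?Q h p)) \<le> \<bar>h\<bar> * (L\<^sup>2 / 2)"
      by (rule order_trans[OF norm_mat_endo_scalar_le])
  qed simp
  have "((\<lambda>h. L2_norm (?D h)) \<longlongrightarrow> 0) (at 0)"
  proof (rule tendsto_ennreal_zero_bound[OF _ _ represents_L2_norm_finite[OF r]])
    show "\<forall>\<^sub>F h in at 0. L2_norm (?D h) \<le> ennreal (\<bar>h\<bar> * (L\<^sup>2 / 2)) * L2_norm \<phi>"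
      using bound by (auto simp: eventually_at_filter)
    have "((\<lambda>h::real. \<bar>h\<bar> * (L\<^sup>2 / 2)) \<longlongrightarrow> \<bar>0\<bar> * (L\<^sup>2 / 2)) (at 0)" by (intro tendsto_intros)
    then show "((\<lambda>h::real. \<bar>h\<bar> * (L\<^sup>2 / 2)) \<longlongrightarrow> 0) (at 0)" by simp
  qed simp
  from represents_limit[OF _ r0 this] show ?thesis
    unfolding L2_partial_def mat_vector_mul by simp
qed

text \<open>For one fixed cutoff \<open>T\<close> has to map the cutoff space to itself, so
  multipliers can be iterated. The symbol is tested only inside the cube, where amplitudes
  live.\<close>

definition multiplier ::
    "real \<Rightarrow> (('d::finite, 'c::finite) state \<Rightarrow> ('d, 'c) state) \<Rightarrow> (real ^ 'd \<Rightarrow> complex ^ 'c ^ 'c) \<Rightarrow> bool" where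
  "multiplier L T S \<longleftrightarrow> (\<forall>\<psi> \<phi>. represents L \<psi> \<phi> \<longrightarrow> represents L (T \<psi>) (\<lambda>p. S p *v \<phi> p))"

lemma multiplierD: "multiplier L T S \<Longrightarrow> represents L \<psi> \<phi> \<Longrightarrow> represents L (T \<psi>) (\<lambda>p. S p *v \<phi> p)"
  by (simp add: multiplier_def)

lemma multiplier_funpow:
  assumes "multiplier L T S"
  shows "multiplier L (T ^^ n) (\<lambda>p. (((**) (S p)) ^^ n) (mat 1))"
proof (induction n)
  case (Suc n)
  show ?case
    using multiplierD[OF assms multiplierD[OF Suc]]
    by (simp add: multiplier_def matrix_vector_mul_assoc)
qed (simp add: multiplier_def)

text \<open>\<open>T\<close> may be unbounded, but its symbol is bounded by \<open>B\<close> on the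
  cube. The exponential series of symbols therefore converges there uniformly in operator norm,
  which is L2 convergence of the partial sums.\<close>

lemma multiplier_op_exp:
  fixes T :: "('d::finite, 'c::finite) state \<Rightarrow> ('d, 'c) state"
  assumes T: "multiplier L T S"
    and bound: "\<And>p. (\<And>b. \<bar>p $ b\<bar> \<le> L) \<Longrightarrow> norm (mat_endo (S p)) \<le> B" and "0 \<le> B"
  shows "multiplier L (op_exp c T) (\<lambda>p. matrix_exp (mat c ** S p))"
  unfolding multiplier_def
proof (intro allI impI)
  fix \<psi> \<phi> :: "('d, 'c) state" assume r: "represents L \<psi> \<phi>"
  then have amp: "amplitude L \<phi>" by (simp add: represents_def)
  let ?Z = "\<lambda>p. mat_endo (mat c ** S p)"
  let ?E = "\<lambda>p. matrix_exp (mat c ** S p)"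
  let ?pow = "\<lambda>k p. ((**) (mat c ** S p) ^^ k) (mat 1)"
  let ?sum = "\<lambda>K p. \<Sum>k<K. (1 / fact k) *\<^sub>R ?pow k p"
  let ?psum = "\<lambda>K x. \<Sum>k<K. (c ^ k / fact k) *s (T ^^ k) \<psi> x"
  have mat_sum: "mat_endo (?sum K p) = (\<Sum>k<K. ?Z p ^ k /\<^sub>R fact k)" for K p
    by (simp add: linear_sum[OF bounded_linear.linear[OF bounded_linear_mat_endo]]
        linear_cmul[OF bounded_linear.linear[OF bounded_linear_mat_endo]] matrix_power_endo divide_inverse)
  \<comment> \<open>\<open>op_exp\<close> keeps the powers of \<open>c\<close> outside the powers of
    \<open>T\<close>, while \<open>matrix_exp\<close> takes powers of the product; the two agree as
    scalars commute with matrices.\<close>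
  have pow_scalar: "c ^ k *s (((**) (S p) ^^ k) (mat 1) *v v) = ?pow k p *v v" for k p v
  proof (induction k)
    case (Suc k)
    have "?pow (Suc k) p *v v = c *s (S p *v (?pow k p *v v))"
      by (simp add: matrix_vector_mul_assoc[symmetric] mat_vector_mul)
    then show ?case
      by (simp add: Suc[symmetric] vector_scalar_commute matrix_vector_mul_assoc[symmetric] vector_smult_assoc)
  qed simp
  have psum: "represents L (?psum K) (\<lambda>p. ?sum K p *v \<phi> p)" for K
  proof -
    have "represents L (?psum K) (\<lambda>p. \<Sum>k<K. (c ^ k / fact k) *s (((**) (S p) ^^ k) (mat 1) *v \<phi> p))"
      by (intro represents_sum represents_scalar multiplierD[OF multiplier_funpow[OF T]] r)
    moreover have "(\<Sum>k<K. (c ^ k / fact k) *s (((**) (S p) ^^ k) (mat 1) *v \<phi> p)) = ?sum K p *v \<phi> p" for p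
    proof -
      have "(c ^ k / fact k) *s (((**) (S p) ^^ k) (mat 1) *v \<phi> p) = app (?Z p ^ k /\<^sub>R fact k) (\<phi> p)" for k
        unfolding app_simps matrix_power_endo[symmetric] app_mat_endo pow_scalar[symmetric]
        by (simp add: scaleR_eq_scalar vector_smult_assoc divide_inverse mult.commute)
      then show ?thesis by (simp only: app_sum[symmetric] mat_sum[symmetric] app_mat_endo)
    qed
    ultimately show ?thesis by simp
  qed
  have Zb: "norm (?Z p) \<le> norm c * B" if "\<And>b. \<bar>p $ b\<bar> \<le> L" for p
    unfolding mat_endo_mult using bound[OF that]
    by (intro order_trans[OF norm_mult_ineq] mult_mono norm_mat_endo_scalar_le) auto
  have lim: "(\<lambda>K. ?sum K p *v \<phi> p) \<longlonglongrightarrow> ?E p *v \<phi> p" for p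
  proof -
    have "(\<lambda>K. app (\<Sum>k<K. ?Z p ^ k /\<^sub>R fact k) (\<phi> p)) \<longlonglongrightarrow> app (exp (?Z p)) (\<phi> p)"
      unfolding exp_def
      by (intro bounded_linear.tendsto[OF bounded_linear_app_left] summable_LIMSEQ summable_exp_generic)
    then show ?thesis by (simp only: mat_sum[symmetric] mat_endo_matrix_exp[symmetric] app_mat_endo)
  qed
  \<comment> \<open>Measurability is inherited from the partial sums, whose amplitudes converge
    pointwise.\<close>
  have "(\<lambda>p. ?E p *v \<phi> p) \<in> borel_measurable borel"
  proof (rule borel_measurable_LIMSEQ_metric[OF _ lim])
    show "(\<lambda>p. ?sum K p *v \<phi> p) \<in> borel_measurable borel" for K
      using psum[of K] by (simp add: represents_def amplitude_def square_integrable_def)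
  qed
  then have "amplitude L (\<lambda>p. ?E p *v \<phi> p)"
  proof (rule amplitude_multiplier(1)[OF amp, where B = "exp (norm c * B)"])
    fix p :: "real ^ 'd" assume "\<And>b. \<bar>p $ b\<bar> \<le> L"
    from Zb[OF this] show "norm (mat_endo (?E p)) \<le> exp (norm c * B)"
      unfolding mat_endo_matrix_exp by (intro order_trans[OF norm_exp]) simp
  qed simp
  then have r0: "represents L (fourier_state (\<lambda>p. ?E p *v \<phi> p)) (\<lambda>p. ?E p *v \<phi> p)"
    by (rule represents_fourier_state)
  let ?D = "\<lambda>K x. ?psum K x - fourier_state (\<lambda>p. ?E p *v \<phi> p) x"
  have "L2_norm (?D K) \<le> ennreal ((norm c * B) ^ K / fact K * exp (norm c * B)) * L2_norm \<phi>" for K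
  proof (rule represents_norm_le[OF _ amp])
    have "represents L (?D K) (\<lambda>p. ?sum K p *v \<phi> p - ?E p *v \<phi> p)"
      by (intro represents_diff psum r0)
    then show "represents L (?D K) (\<lambda>p. (?sum K p - ?E p) *v \<phi> p)"
      by (simp add: matrix_vector_mult_diff_rdistrib)
    fix p :: "real ^ 'd" assume p: "\<And>b. \<bar>p $ b\<bar> \<le> L"
    have "norm (mat_endo (?sum K p - ?E p)) = norm (exp (?Z p) - (\<Sum>k<K. ?Z p ^ k /\<^sub>R fact k))"
      by (simp only: linear_diff[OF bounded_linear.linear[OF bounded_linear_mat_endo]] mat_sum
          mat_endo_matrix_exp norm_minus_commute)
    also have "\<dots> \<le> norm (?Z p) ^ K / fact K * exp (norm (?Z p))"
      by (rule norm_exp_minus_partial_sum_le)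
    also have "\<dots> \<le> (norm c * B) ^ K / fact K * exp (norm c * B)"
      using Zb[OF p] \<open>0 \<le> B\<close> by (intro mult_mono divide_right_mono power_mono) auto
    finally show "norm (mat_endo (?sum K p - ?E p)) \<le> (norm c * B) ^ K / fact K * exp (norm c * B)" .
  qed (use \<open>0 \<le> B\<close> in simp)
  moreover have "(\<lambda>K. (norm c * B) ^ K / fact K * exp (norm c * B)) \<longlonglongrightarrow> 0"
    using summable_LIMSEQ_zero[OF summable_exp[of "norm c * B"]]
    by (intro tendsto_mult_left_zero) (simp add: divide_inverse mult.commute)
  ultimately have "(\<lambda>K. L2_norm (?D K)) \<longlonglongrightarrow> 0"
    using \<open>0 \<le> B\<close> by (intro tendsto_ennreal_zero_bound[OF _ _ represents_L2_norm_finite[OF r]]) auto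
  from represents_limit[OF _ r0 this]
  show "represents L (op_exp c T \<psi>) (\<lambda>p. ?E p *v \<phi> p)"
    unfolding op_exp_def by (subst L2_norm_minus_commute) simp
qed

section \<open>Symbols of the walk and of its Hamiltonian\<close>

definition qdot :: "int ^ 'd \<Rightarrow> real ^ 'd::finite \<Rightarrow> real" where
  "qdot q p = (\<Sum>b\<in>UNIV. of_int (q $ b) * p $ b)"

text \<open>The l1 norm of \<open>q\<close>, dual to the maximum norm that defines the momentum
  cube.\<close>

definition qsize :: "int ^ 'd::finite \<Rightarrow> real" where
  "qsize q = (\<Sum>b\<in>UNIV. \<bar>of_int (q $ b)\<bar>)"

lemma qsize_nonneg: "0 \<le> qsize q"
  unfolding qsize_def by (intro sum_nonneg) simp

lemma qdot_add: "qdot (q + r) p = qdot q p + qdot r p"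
  by (simp add: qdot_def distrib_right sum.distrib)

lemma qdot_minus: "qdot (- q) p = - qdot q p"
  by (simp add: qdot_def sum_negf)

lemma abs_qdot_le:
  fixes q :: "int ^ 'd::finite"
  assumes "\<And>b. \<bar>p $ b\<bar> \<le> L"
  shows "\<bar>qdot q p\<bar> \<le> qsize q * L"
proof -
  have "\<bar>qdot q p\<bar> \<le> (\<Sum>b\<in>UNIV. \<bar>of_int (q $ b) * p $ b\<bar>)"
    unfolding qdot_def by (rule sum_abs)
  also have "\<dots> \<le> (\<Sum>b\<in>UNIV. \<bar>of_int (q $ b)\<bar> * L)"
    unfolding abs_mult by (intro sum_mono mult_left_mono assms) simp
  finally show ?thesis by (simp add: qsize_def sum_distrib_right)
qed

text \<open>The lattice Fourier symbol, in which the shift by \<open>q\<close> becomes the phase exp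
  (- i q . p). The continuum step of spacing \<open>a\<close> evaluates it at
  \<open>a *\<^sub>R p\<close>.\<close>

definition walk_symbol ::
    "(int ^ 'd) set \<Rightarrow> (int ^ 'd \<Rightarrow> complex ^ 'c ^ 'c) \<Rightarrow> (real ^ 'd::finite) \<Rightarrow> complex ^ 'c ^ 'c::finite" where
  "walk_symbol Q A p = (\<Sum>q\<in>Q. A q ** mat (cis (- qdot q p)))"

definition hamiltonian_symbol ::
    "(int ^ 'd) set \<Rightarrow> (int ^ 'd \<Rightarrow> complex ^ 'c ^ 'c) \<Rightarrow> complex ^ 'c ^ 'c \<Rightarrow> (real ^ 'd::finite) \<Rightarrow> complex ^ 'c ^ 'c::finite" where
  "hamiltonian_symbol Q A M p = (\<Sum>q\<in>Q. A q ** mat (of_real (qdot q p))) + M"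

lemma matrix_vector_mult_sum: "(\<Sum>i\<in>I. B i) *v v = (\<Sum>i\<in>I. B i *v v)"
  for B :: "_ \<Rightarrow> complex ^ 'c ^ 'c"
  by (induction I rule: infinite_finite_induct) (simp_all add: matrix_vector_mult_add_rdistrib)

lemma mat_endo_sum: "mat_endo (\<Sum>i\<in>I. B i) = (\<Sum>i\<in>I. mat_endo (B i))"
  by (rule linear_sum[OF bounded_linear.linear[OF bounded_linear_mat_endo]])

lemma mat_endo_add: "mat_endo (A + B) = mat_endo A + mat_endo B"
  by (rule linear_add[OF bounded_linear.linear[OF bounded_linear_mat_endo]])

lemma multiplier_dot_momentum: "multiplier L (dot_momentum q) (\<lambda>p. mat (of_real (qdot q p)))"
  unfolding multiplier_def
proof (intro allI impI)
  fix \<psi> \<phi> :: "('a, 'b) state" assume r: "represents L \<psi> \<phi>"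
  have "represents L (dot_momentum q \<psi>)
      (\<lambda>p. \<Sum>b\<in>UNIV. of_int (q $ b) *s ((- \<i>) *s ((\<i> * of_real (p $ b)) *s \<phi> p)))"
    unfolding dot_momentum_def momentum_def
    by (intro represents_sum represents_scalar represents_L2_partial r)
  moreover have "(\<Sum>b\<in>UNIV. of_int (q $ b) *s ((- \<i>) *s ((\<i> * of_real (p $ b)) *s \<phi> p)))
      = mat (of_real (qdot q p)) *v \<phi> p" for p
    by (simp add: mat_vector_mul vec_eq_iff qdot_def sum_distrib_right mult.assoc)
  ultimately show "represents L (dot_momentum q \<psi>) (\<lambda>p. mat (of_real (qdot q p)) *v \<phi> p)" by simp
qed

lemma multiplier_hamiltonian: "multiplier L (hamiltonian Q A M) (hamiltonian_symbol Q A M)"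
  unfolding multiplier_def
proof (intro allI impI)
  fix \<psi> \<phi> :: "('a, 'b) state" assume r: "represents L \<psi> \<phi>"
  have "represents L (hamiltonian Q A M \<psi>) (\<lambda>p. (\<Sum>q\<in>Q. A q *v (mat (of_real (qdot q p)) *v \<phi> p)) + M *v \<phi> p)"
    unfolding hamiltonian_def
    by (intro represents_add represents_sum represents_matrix multiplierD[OF multiplier_dot_momentum] r)
  then show "represents L (hamiltonian Q A M \<psi>) (\<lambda>p. hamiltonian_symbol Q A M p *v \<phi> p)"
    by (simp add: hamiltonian_symbol_def matrix_vector_mult_add_rdistrib matrix_vector_mult_sum matrix_vector_mul_assoc)
qed

lemma qdot_scaleR: "qdot q (a *\<^sub>R p) = a * qdot q p"
  by (simp add: qdot_def sum_distrib_left mult_ac)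

text \<open>The shift exponents have scalar symbols, whose exponentials are phases; absorbing
  \<open>a\<close> into the momentum exhibits the symbol of the lattice walk itself.\<close>

lemma multiplier_walk_step:
  fixes A :: "int ^ 'd::finite \<Rightarrow> complex ^ 'c ^ 'c::finite"
  shows "multiplier L (walk_step Q A M a)
    (\<lambda>p. matrix_exp (mat (- \<i> * of_real a) ** M) ** walk_symbol Q A (a *\<^sub>R p))"
  unfolding multiplier_def
proof (intro allI impI)
  fix \<psi> \<phi> :: "('d, 'c) state" assume r: "represents L \<psi> \<phi>"
  let ?c = "- \<i> * of_real a"
  have shift: "represents L (op_exp ?c (dot_momentum q) \<psi>) (\<lambda>p. mat (cis (- qdot q (a *\<^sub>R p))) *v \<phi> p)" for q
  proof -
    have "multiplier L (op_exp ?c (dot_momentum q))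
        (\<lambda>p. matrix_exp (mat ?c ** mat (of_real (qdot q p))) :: complex ^ 'c ^ 'c)"
    proof (rule multiplier_op_exp[OF multiplier_dot_momentum, where B = "qsize q * \<bar>L\<bar>"])
      fix p :: "real ^ 'd" assume "\<And>b. \<bar>p $ b\<bar> \<le> L"
      then have "\<bar>p $ b\<bar> \<le> \<bar>L\<bar>" for b using abs_ge_self[of L] order_trans by blast
      from abs_qdot_le[OF this]
      show "norm (mat_endo (mat (of_real (qdot q p)) :: complex ^ 'c ^ 'c)) \<le> qsize q * \<bar>L\<bar>"
        by (intro order_trans[OF norm_mat_endo_scalar_le]) simp
    qed (simp add: qsize_nonneg)
    moreover have "matrix_exp (mat ?c ** mat (of_real (qdot q p))) = (mat (cis (- qdot q (a *\<^sub>R p))) :: complex ^ 'c ^ 'c)" for p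
    proof (rule mat_endo_inject)
      have "mat_endo (mat ?c ** mat (of_real (qdot q p))) = (mat_endo (mat (\<i> * of_real (- qdot q (a *\<^sub>R p)))) :: (complex ^ 'c) endo)"
        by (rule endo_eqI) (simp add: matrix_vector_mul_assoc[symmetric] mat_vector_mul qdot_scaleR vector_smult_assoc)
      then show "mat_endo (matrix_exp (mat ?c ** mat (of_real (qdot q p)))) = (mat_endo (mat (cis (- qdot q (a *\<^sub>R p)))) :: (complex ^ 'c) endo)"
        by (simp only: mat_endo_matrix_exp exp_mat_endo_scalar cis_conv_exp)
    qed
    ultimately show ?thesis using r by (simp add: multiplier_def)
  qed
  have "represents L (walk_step Q A M a \<psi>)
      (\<lambda>p. matrix_exp (mat ?c ** M) *v (\<Sum>q\<in>Q. A q *v (mat (cis (- qdot q (a *\<^sub>R p))) *v \<phi> p)))"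
    unfolding walk_step_def by (intro represents_matrix represents_sum shift)
  then show "represents L (walk_step Q A M a \<psi>)
      (\<lambda>p. (matrix_exp (mat ?c ** M) ** walk_symbol Q A (a *\<^sub>R p)) *v \<phi> p)"
    by (simp add: walk_symbol_def matrix_vector_mul_assoc[symmetric] matrix_vector_mult_sum)
qed

section \<open>Unitarity of the symbol\<close>

lemma infsum_finite_support:
  fixes f :: "'a \<Rightarrow> 'b::{comm_monoid_add, t2_space}"
  assumes "finite S" "\<And>n. n \<notin> S \<Longrightarrow> f n = 0"
  shows "(\<Sum>\<^sub>\<infinity>n. f n) = sum f S"
proof -
  have "(\<Sum>\<^sub>\<infinity>n. f n) = infsum f S" by (rule infsum_cong_neutral) (use assms in auto)
  then show ?thesis using assms by simp
qed

definition delta_state :: "int ^ 'd \<Rightarrow> complex ^ 'c \<Rightarrow> ('d::finite, 'c::finite) lattice_state" where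
  "delta_state r v = (\<lambda>n. if n = r then v else 0)"

lemma delta_state_l2: "delta_state r v \<in> lattice_l2"
proof -
  have "(\<lambda>n. (norm (delta_state r v n))\<^sup>2) summable_on {r}" by (rule summable_on_finite) simp
  then have "(\<lambda>n. (norm (delta_state r v n))\<^sup>2) summable_on UNIV"
    by (rule summable_on_cong_neutral[THEN iffD1, rotated -1]) (auto simp: delta_state_def)
  then show ?thesis by (simp add: lattice_l2_def)
qed

lemma coin_inner_zero [simp]: "coin_inner 0 v = 0" "coin_inner u 0 = 0"
  by (simp_all add: coin_inner_def)

lemma lattice_walk_delta:
  assumes "finite Q"
  shows "lattice_walk Q A (delta_state r v) n = (if n - r \<in> Q then A (n - r) *v v else 0)"
proof -
  have "lattice_walk Q A (delta_state r v) n = (\<Sum>q\<in>Q. if q = n - r then A (n - r) *v v else 0)"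
    unfolding lattice_walk_def lattice_shift_def delta_state_def
    by (intro sum.cong refl) (auto simp: algebra_simps)
  then show ?thesis using assms by (simp add: sum.delta)
qed

text \<open>Compare the images of two states localised at 0 and at \<open>r\<close> with the same
  coin vector: their inner product is the sum on the left, and before the walk they are orthogonal
  unless \<open>r = 0\<close>.\<close>

lemma lattice_unitary_orthogonality:
  fixes A :: "int ^ 'd::finite \<Rightarrow> complex ^ 'c ^ 'c::finite"
  assumes Q: "finite Q" and U: "lattice_unitary (lattice_walk Q A)"
  shows "(\<Sum>n\<in>Q. if n - r \<in> Q then coin_inner (A n *v v) (A (n - r) *v v) else 0)
    = (if r = 0 then coin_inner v v else 0)"
proof -
  have "(\<Sum>n\<in>Q. if n - r \<in> Q then coin_inner (A n *v v) (A (n - r) *v v) else 0)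
      = (\<Sum>n\<in>Q. coin_inner (lattice_walk Q A (delta_state 0 v) n) (lattice_walk Q A (delta_state r v) n))"
    by (intro sum.cong refl) (simp add: lattice_walk_delta[OF Q])
  also have "\<dots> = lattice_inner (lattice_walk Q A (delta_state 0 v)) (lattice_walk Q A (delta_state r v))"
    unfolding lattice_inner_def
    by (rule infsum_finite_support[OF Q, symmetric]) (simp add: lattice_walk_delta[OF Q])
  also have "\<dots> = lattice_inner (delta_state 0 v) (delta_state r v)"
    using U delta_state_l2 unfolding lattice_unitary_def by blast
  also have "\<dots> = (\<Sum>n\<in>{0}. coin_inner (delta_state 0 v n) (delta_state r v n))"
    unfolding lattice_inner_def by (rule infsum_finite_support) (auto simp: delta_state_def)
  also have "\<dots> = (if r = 0 then coin_inner v v else 0)"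
    by (simp add: delta_state_def)
  finally show ?thesis .
qed

lemma coin_inner_self: "coin_inner v v = of_real ((norm v)\<^sup>2)"
  by (simp add: coin_inner_def norm_vec_power2 complex_norm_square mult.commute del: of_real_power)

lemma coin_inner_sum:
  "coin_inner (\<Sum>n\<in>Q. c n *s x n) (\<Sum>m\<in>Q. c m *s x m)
    = (\<Sum>n\<in>Q. \<Sum>m\<in>Q. cnj (c n) * c m * coin_inner (x n) (x m))"
proof -
  have "coin_inner (\<Sum>n\<in>Q. c n *s x n) (\<Sum>m\<in>Q. c m *s x m)
      = (\<Sum>i\<in>UNIV. \<Sum>n\<in>Q. \<Sum>m\<in>Q. cnj (c n) * c m * (cnj (x n $ i) * x m $ i))"
    unfolding coin_inner_def sum_component vector_smult_component cnj_sum sum_product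
    by (intro sum.cong refl) (simp add: mult_ac)
  also have "\<dots> = (\<Sum>n\<in>Q. \<Sum>m\<in>Q. \<Sum>i\<in>UNIV. cnj (c n) * c m * (cnj (x n $ i) * x m $ i))"
    by (subst sum.swap) (intro sum.cong refl, rule sum.swap)
  finally show ?thesis by (simp add: coin_inner_def sum_distrib_left)
qed

text \<open>Expand the squared norm as a double sum over shifts \<open>n\<close> and
  \<open>m\<close>. The phase depends only on \<open>r = n - m\<close>, so grouping by
  \<open>r\<close> leaves the sums of \<open>lattice_unitary_orthogonality\<close>, of which only
  \<open>r = 0\<close> survives.\<close>

lemma norm_walk_symbol:
  fixes A :: "int ^ 'd::finite \<Rightarrow> complex ^ 'c ^ 'c::finite"
  assumes Q: "finite Q" and U: "lattice_unitary (lattice_walk Q A)"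
  shows "norm (walk_symbol Q A p *v v) = norm v"
proof -
  define c where "c = (\<lambda>q. cis (- qdot q p))"
  \<comment> \<open>Inserting 0 keeps the term \<open>r = 0\<close> present without a case
    distinction on whether \<open>Q\<close> is empty.\<close>
  define R where "R = insert 0 ((\<lambda>(n, m). n - m) ` (Q \<times> Q))"
  let ?g = "\<lambda>n m. cnj (c n) * c m * coin_inner (A n *v v) (A m *v v)"
  have fin: "finite R" using Q by (simp add: R_def)
  have cc: "cnj (c n) * c (n - r) = c (- r)" for n r
    using qdot_add[of "n - r" r p] by (simp add: c_def cis_cnj cis_mult qdot_minus)
  \<comment> \<open>The guard lets \<open>r\<close> range over a set independent of
    \<open>n\<close>, so that the two sums can be exchanged.\<close>
  have inner_sum: "(\<Sum>m\<in>Q. ?g n m) = (\<Sum>r\<in>R. if n - r \<in> Q then ?g n (n - r) else 0)" if n: "n \<in> Q" for n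
  proof -
    have "(\<Sum>r\<in>R. if n - r \<in> Q then ?g n (n - r) else 0) = (\<Sum>r\<in>{r \<in> R. n - r \<in> Q}. ?g n (n - r))"
      using fin by (simp add: sum.inter_filter)
    also have "\<dots> = (\<Sum>m\<in>Q. ?g n m)"
      by (rule sum.reindex_bij_witness[of _ "\<lambda>m. n - m" "\<lambda>r. n - r"]) (use n in \<open>auto simp: R_def\<close>)
    finally show ?thesis ..
  qed
  have W: "walk_symbol Q A p *v v = (\<Sum>q\<in>Q. c q *s (A q *v v))"
    by (simp add: walk_symbol_def c_def matrix_vector_mult_sum matrix_vector_mul_assoc[symmetric]
        mat_vector_mul vector_scalar_commute)
  have "coin_inner (walk_symbol Q A p *v v) (walk_symbol Q A p *v v) = (\<Sum>n\<in>Q. \<Sum>m\<in>Q. ?g n m)"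
    unfolding W by (rule coin_inner_sum)
  also have "\<dots> = (\<Sum>n\<in>Q. \<Sum>r\<in>R. if n - r \<in> Q then ?g n (n - r) else 0)"
    by (intro sum.cong refl inner_sum)
  also have "\<dots> = (\<Sum>r\<in>R. \<Sum>n\<in>Q. if n - r \<in> Q then ?g n (n - r) else 0)"
    by (rule sum.swap)
  also have "\<dots> = (\<Sum>r\<in>R. c (- r) * (\<Sum>n\<in>Q. if n - r \<in> Q then coin_inner (A n *v v) (A (n - r) *v v) else 0))"
    unfolding sum_distrib_left by (intro sum.cong refl) (simp add: cc)
  also have "\<dots> = (\<Sum>r\<in>R. if r = 0 then coin_inner v v else 0)"
    unfolding lattice_unitary_orthogonality[OF Q U]
    by (intro sum.cong refl) (auto simp: c_def qdot_def)
  also have "\<dots> = coin_inner v v" using fin by (simp add: R_def)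
  finally have "(norm (walk_symbol Q A p *v v))\<^sup>2 = (norm v)\<^sup>2"
    unfolding coin_inner_self of_real_eq_iff .
  then show ?thesis by (simp add: power2_eq_iff_nonneg)
qed

section \<open>The continuum limit\<close>

text \<open>Only the kinetic part, which grows with the cutoff; the mass contributes a constant and
  is added separately.\<close>

lemma hamiltonian_symbol_bound:
  fixes A :: "int ^ 'd::finite \<Rightarrow> complex ^ 'c ^ 'c::finite"
  assumes "\<And>b. \<bar>p $ b\<bar> \<le> L"
  shows "norm (mat_endo (\<Sum>q\<in>Q. A q ** mat (of_real (qdot q p)))) \<le> (\<Sum>q\<in>Q. norm (mat_endo (A q)) * qsize q) * L"
proof -
  have "norm (mat_endo (A q ** mat (of_real (qdot q p)))) \<le> norm (mat_endo (A q)) * (qsize q * L)" for q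
    unfolding mat_endo_mult using abs_qdot_le[OF assms]
    by (intro order_trans[OF norm_mult_ineq] mult_left_mono order_trans[OF norm_mat_endo_scalar_le]) auto
  then show ?thesis
    unfolding mat_endo_sum sum_distrib_right mult.assoc by (intro order_trans[OF norm_sum] sum_mono)
qed

text \<open>The order-zero term is the identity because the coin operators sum to it, and the linear
  term is - i times the kinetic symbol. What is left is the Taylor remainder of each phase.\<close>

lemma walk_symbol_remainder:
  fixes A :: "int ^ 'd::finite \<Rightarrow> complex ^ 'c ^ 'c::finite"
  assumes A: "(\<Sum>q\<in>Q. A q) = mat 1" and p: "\<And>b. \<bar>p $ b\<bar> \<le> L"
  shows "norm (mat_endo (walk_symbol Q A p) - 1 - mat_endo (mat (- \<i>) ** (\<Sum>q\<in>Q. A q ** mat (of_real (qdot q p)))))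
    \<le> (\<Sum>q\<in>Q. norm (mat_endo (A q)) * (qsize q)\<^sup>2) * L\<^sup>2"
proof -
  let ?z = "\<lambda>q. cis (- qdot q p) - 1 - \<i> * of_real (- qdot q p)"
  have one: "(1 :: (complex ^ 'c) endo) = (\<Sum>q\<in>Q. mat_endo (A q))"
    using A by (simp add: mat_endo_sum[symmetric] mat_endo_one)
  have "mat_endo (walk_symbol Q A p) - 1 - mat_endo (mat (- \<i>) ** (\<Sum>q\<in>Q. A q ** mat (of_real (qdot q p))))
      = (\<Sum>q\<in>Q. mat_endo (A q) * mat_endo (mat (?z q)))"
    by (rule endo_eqI)
      (simp add: one app_simps app_sum walk_symbol_def matrix_vector_mult_sum matrix_vector_mul_assoc[symmetric]
        mat_vector_mul vector_scalar_commute vec_eq_iff sum_subtractf sum.distrib sum_distrib_left algebra_simps)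
  also have "norm \<dots> \<le> (\<Sum>q\<in>Q. norm (mat_endo (A q)) * ((qsize q)\<^sup>2 * L\<^sup>2))"
  proof (intro order_trans[OF norm_sum] sum_mono order_trans[OF norm_mult_ineq] mult_left_mono norm_ge_zero)
    fix q
    have "norm (mat_endo (mat (?z q) :: complex ^ 'c ^ 'c)) \<le> (- qdot q p)\<^sup>2 / 2"
      by (rule order_trans[OF norm_mat_endo_scalar_le norm_cis_minus_1_minus_le])
    also have "\<dots> \<le> \<bar>qdot q p\<bar>\<^sup>2" by simp
    also have "\<dots> \<le> (qsize q * L)\<^sup>2" by (intro power_mono abs_qdot_le p) simp
    finally show "norm (mat_endo (mat (?z q) :: complex ^ 'c ^ 'c)) \<le> (qsize q)\<^sup>2 * L\<^sup>2"
      by (simp add: power_mult_distrib)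
  qed
  finally show ?thesis by (simp add: sum_distrib_right mult.assoc)
qed

text \<open>The constant \<open>m\<close> is the norm of \<open>M\<close>: a mass step has norm at most \<open>exp (m * a)\<close>, whose
  \<open>N\<close>-th power stays bounded because \<open>N * a = t\<close>.\<close>

lemma symbol_error:
  fixes A :: "int ^ 'd::finite \<Rightarrow> complex ^ 'c ^ 'c::finite" and M :: "complex ^ 'c ^ 'c"
  assumes Q: "finite Q" and U: "lattice_unitary (lattice_walk Q A)" and A: "(\<Sum>q\<in>Q. A q) = mat 1"
  obtains m C where "0 \<le> C" and
    "\<forall>a L N p. 0 < a \<longrightarrow> 1 \<le> L \<longrightarrow> a * L \<le> 1 \<longrightarrow> (\<forall>b. \<bar>p $ b\<bar> \<le> L) \<longrightarrow>
       norm (mat_endo (matrix_exp (mat (- \<i> * of_real (real N * a)) ** hamiltonian_symbol Q A M p)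
         - ((**) (matrix_exp (mat (- \<i> * of_real a) ** M) ** walk_symbol Q A (a *\<^sub>R p)) ^^ N) (mat 1)))
       \<le> real N * exp (real N * (m * a + C * (a * L)\<^sup>2)) * (C * (a * L)\<^sup>2)"
proof -
  define m where "m = norm (mat_endo M)"
  define d where "d = (\<Sum>q\<in>Q. norm (mat_endo (A q)) * qsize q)"
  define k where "k = (\<Sum>q\<in>Q. norm (mat_endo (A q)) * (qsize q)\<^sup>2)"
  \<comment> \<open>The constant of \<open>split_step_error\<close>, built from coin operators and
    shifts alone, hence uniform in \<open>a\<close>, \<open>L\<close>, \<open>N\<close> and
    \<open>p\<close>.\<close>
  define C where "C = m * exp m * (d + k) + m\<^sup>2 * exp m + k + (m + d)\<^sup>2 * exp (m + d)"
  have nn: "0 \<le> m" "0 \<le> d" "0 \<le> k"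
    unfolding m_def d_def k_def by (auto intro!: sum_nonneg mult_nonneg_nonneg qsize_nonneg)
  then have C: "0 \<le> C" unfolding C_def by (intro add_nonneg_nonneg mult_nonneg_nonneg) auto
  show thesis
  proof (rule that[OF C], intro allI impI)
    fix a L :: real and N :: nat and p :: "real ^ 'd"
    assume a: "0 < a" and L: "1 \<le> L" and aL: "a * L \<le> 1" and "\<forall>b. \<bar>p $ b\<bar> \<le> L"
    then have p: "\<bar>p $ b\<bar> \<le> L" for b by blast
    let ?c = "- \<i> * complex_of_real a"
    \<comment> \<open>With the spacing absorbed into the momentum, \<open>?X + ?D\<close> is - i a
      times the Hamiltonian symbol at \<open>p\<close>.\<close>
    let ?Y = "\<Sum>q\<in>Q. A q ** mat (of_real (qdot q (a *\<^sub>R p)))"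
    let ?X = "mat_endo (mat ?c ** M)" and ?D = "mat_endo (mat (- \<i>) ** ?Y)"
    let ?W = "mat_endo (walk_symbol Q A (a *\<^sub>R p))"
    have ap: "\<bar>(a *\<^sub>R p) $ b\<bar> \<le> a * L" for b
      using p[of b] a by (simp add: abs_mult)
    have s: "0 \<le> a * L" using a L by simp
    have X: "norm ?X \<le> m * a"
      unfolding mat_endo_mult m_def
      using mult_right_mono[OF norm_mat_endo_scalar_le[of ?c], of "norm (mat_endo M)"] a
      by (intro order_trans[OF norm_mult_ineq]) (simp add: norm_mult mult.commute)
    \<comment> \<open>The weaker bound puts the mass on the common scale \<open>a * L\<close> of
      \<open>split_step_error\<close>; the sharper one is kept for the growth of powers.\<close>
    have X': "norm ?X \<le> m * (a * L)"
      using X mult_left_mono[of a "a * L" m] nn a L by simp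
    have D: "norm ?D \<le> d * (a * L)"
    proof -
      have "norm ?D \<le> norm (mat_endo (mat (- \<i>) :: complex ^ 'c ^ 'c)) * norm (mat_endo ?Y)"
        unfolding mat_endo_mult by (rule norm_mult_ineq)
      also have "\<dots> \<le> 1 * (d * (a * L))"
        using norm_mat_endo_scalar_le[of "- \<i>", where 'c = 'c] hamiltonian_symbol_bound[OF ap, of A Q]
        by (intro mult_mono) (auto simp: d_def)
      finally show ?thesis by simp
    qed
    have W: "norm (?W - 1 - ?D) \<le> k * (a * L)\<^sup>2"
      unfolding k_def by (rule walk_symbol_remainder[OF A ap])
    have err: "norm (exp (?X + ?D) - exp ?X * ?W) \<le> C * (a * L)\<^sup>2"
      unfolding C_def by (rule split_step_error[OF X' D W s aL nn])
    \<comment> \<open>One bound for both steps, in exponential form so that its \<open>N\<close>-th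
      power only multiplies the exponent.\<close>
    define r where "r = exp (m * a + C * (a * L)\<^sup>2)"
    have W1: "norm ?W \<le> 1"
      by (rule norm_endo_bound) (simp_all add: norm_walk_symbol[OF Q U])
    have U_le: "norm (exp ?X * ?W) \<le> exp (m * a)"
    proof -
      have "norm (exp ?X * ?W) \<le> norm (exp ?X) * norm ?W" by (rule norm_mult_ineq)
      also have "\<dots> \<le> exp (m * a) * 1"
        using X W1 by (intro mult_mono order_trans[OF norm_exp]) auto
      finally show ?thesis by simp
    qed
    have e1: "1 \<le> exp (m * a)" using nn a by simp
    have U_r: "norm (exp ?X * ?W) \<le> r"
      using U_le C by (rule_tac order_trans) (auto simp: r_def)
    \<comment> \<open>The Hamiltonian step is bounded through the walk step and their distance;
      \<open>1 + x \<le> exp x\<close> then brings the sum into the form of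
      \<open>r\<close>.\<close>
    have V_r: "norm (exp (?X + ?D)) \<le> r"
    proof -
      have "norm (exp (?X + ?D)) \<le> norm (exp ?X * ?W) + norm (exp (?X + ?D) - exp ?X * ?W)"
        by (rule norm_triangle_sub)
      also have "\<dots> \<le> exp (m * a) * 1 + exp (m * a) * (C * (a * L)\<^sup>2)"
        using U_le err mult_right_mono[OF e1, of "C * (a * L)\<^sup>2"] C by simp
      also have "\<dots> = exp (m * a) * (1 + C * (a * L)\<^sup>2)" by (simp add: distrib_left)
      also have "\<dots> \<le> exp (m * a) * exp (C * (a * L)\<^sup>2)"
        by (intro mult_left_mono exp_ge_add_one_self) simp
      finally show ?thesis by (simp add: r_def exp_add)
    qed
    have r1: "1 \<le> r" using nn a C by (simp add: r_def)
    \<comment> \<open>This makes the evolution over time \<open>N * a\<close> the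
      \<open>N\<close>-th power of the evolution over \<open>a\<close>, so that powers can be
      compared.\<close>
    have "mat (- \<i> * of_real (real N * a)) ** hamiltonian_symbol Q A M p *v v
        = app (real N *\<^sub>R (?X + ?D)) v" for v
      by (simp add: app_simps hamiltonian_symbol_def matrix_vector_mul_assoc[symmetric] mat_vector_mul
          matrix_vector_mult_add_rdistrib matrix_vector_mult_sum vec_eq_iff scaleR_conv_of_real[where 'a = complex]
          vector_scalar_commute qdot_scaleR sum_distrib_left algebra_simps)
    then have "mat_endo (mat (- \<i> * of_real (real N * a)) ** hamiltonian_symbol Q A M p) = real N *\<^sub>R (?X + ?D)"
      by (intro endo_eqI) simp
    then have "mat_endo (matrix_exp (mat (- \<i> * of_real (real N * a)) ** hamiltonian_symbol Q A M p)
         - ((**) (matrix_exp (mat ?c ** M) ** walk_symbol Q A (a *\<^sub>R p)) ^^ N) (mat 1))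
        = exp (?X + ?D) ^ N - (exp ?X * ?W) ^ N"
      by (simp only: linear_diff[OF bounded_linear.linear[OF bounded_linear_mat_endo]] mat_endo_matrix_exp
          matrix_power_endo mat_endo_mult[of "matrix_exp _"] exp_power_nat)
    also have "norm \<dots> \<le> real N * r ^ N * norm (exp (?X + ?D) - exp ?X * ?W)"
      by (rule norm_power_diff_le[OF U_r V_r r1])
    also have "\<dots> \<le> real N * r ^ N * (C * (a * L)\<^sup>2)"
      using r1 by (intro mult_left_mono err mult_nonneg_nonneg) auto
    also have "r ^ N = exp (real N * (m * a + C * (a * L)\<^sup>2))"
      by (simp add: r_def exp_of_nat_mult)
    finally show "norm (mat_endo (matrix_exp (mat (- \<i> * of_real (real N * a)) ** hamiltonian_symbol Q A M p)
         - ((**) (matrix_exp (mat ?c ** M) ** walk_symbol Q A (a *\<^sub>R p)) ^^ N) (mat 1)))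
       \<le> real N * exp (real N * (m * a + C * (a * L)\<^sup>2)) * (C * (a * L)\<^sup>2)" .
  qed
qed

theorem corollary3p5:
  fixes M :: "complex ^ 'c ^ 'c"
    and Q :: "(int ^ 'd) set"
    and A :: "int ^ 'd \<Rightarrow> complex ^ 'c ^ 'c"
    and t :: real
    and \<Lambda> :: "real \<Rightarrow> real"
  assumes "self_adjoint M"
    and "finite Q"
    and "lattice_unitary (lattice_walk Q A)"
    and "(\<Sum>q\<in>Q. A q) = mat 1"
    and "t > 0"
    and "filterlim \<Lambda> at_top (spacing_to_0 t)"
    and "((\<lambda>a. (\<Lambda> a)\<^sup>2 * a) \<longlongrightarrow> 0) (spacing_to_0 t)"
  shows "((\<lambda>a. cutoff_norm (\<Lambda> a)
            (\<lambda>\<psi> x. op_exp (- \<i> * of_real t) (hamiltonian Q A M) \<psi> x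
                   - (walk_step Q A M a ^^ nat \<lfloor>t / a\<rfloor>) \<psi> x)) \<longlongrightarrow> 0) (spacing_to_0 t)"
proof -
  obtain m C where C: "0 \<le> C" and err:
    "\<forall>a L N p. 0 < a \<longrightarrow> 1 \<le> L \<longrightarrow> a * L \<le> 1 \<longrightarrow> (\<forall>b. \<bar>p $ b\<bar> \<le> L) \<longrightarrow>
       norm (mat_endo (matrix_exp (mat (- \<i> * of_real (real N * a)) ** hamiltonian_symbol Q A M p)
         - ((**) (matrix_exp (mat (- \<i> * of_real a) ** M) ** walk_symbol Q A (a *\<^sub>R p)) ^^ N) (mat 1)))
       \<le> real N * exp (real N * (m * a + C * (a * L)\<^sup>2)) * (C * (a * L)\<^sup>2)"
    by (rule symbol_error[OF assms(2,3,4), of M])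
  \<comment> \<open>The bound of \<open>symbol_error\<close> rewritten with
    \<open>N * a = t\<close>: there \<open>N * (a * L)\<^sup>2\<close> becomes
    \<open>t * (L\<^sup>2 * a)\<close>, the quantity that the growth condition on the cutoff sends
    to 0.\<close>
  define e where "e = (\<lambda>a. exp (m * t + C * (t * ((\<Lambda> a)\<^sup>2 * a))) * (C * (t * ((\<Lambda> a)\<^sup>2 * a))))"
  have "(e \<longlongrightarrow> exp (m * t + C * (t * 0)) * (C * (t * 0))) (spacing_to_0 t)"
    unfolding e_def by (intro tendsto_intros assms)
  then have e_lim: "(e \<longlongrightarrow> 0) (spacing_to_0 t)" by simp
  have "\<forall>\<^sub>F a in spacing_to_0 t. a > 0 \<and> t / a \<in> \<int>"
    unfolding spacing_to_0_def by (auto simp: eventually_at_filter)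
  moreover have "\<forall>\<^sub>F a in spacing_to_0 t. 1 \<le> \<Lambda> a"
    using assms(6) by (simp add: filterlim_at_top)
  moreover have "\<forall>\<^sub>F a in spacing_to_0 t. (\<Lambda> a)\<^sup>2 * a < 1"
    using order_tendstoD(2)[OF assms(7), of 1] by simp
  ultimately have ev: "\<forall>\<^sub>F a in spacing_to_0 t. 0 \<le> e a \<and>
      cutoff_norm (\<Lambda> a) (\<lambda>\<psi> x. op_exp (- \<i> * of_real t) (hamiltonian Q A M) \<psi> x
                   - (walk_step Q A M a ^^ nat \<lfloor>t / a\<rfloor>) \<psi> x) \<le> ennreal (e a)"
  proof eventually_elim
    case (elim a)
    then have a: "a > 0" and L: "1 \<le> \<Lambda> a" and La: "(\<Lambda> a)\<^sup>2 * a < 1" by auto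
    define N where "N = nat \<lfloor>t / a\<rfloor>"
    \<comment> \<open>The filter admits only spacings with \<open>t / a\<close> integral, so the
      floor is exact.\<close>
    have N: "real N * a = t"
    proof -
      have "real_of_int \<lfloor>t / a\<rfloor> = t / a" using elim by (simp add: of_int_floor)
      moreover have "0 \<le> t / a" using a assms(5) by simp
      ultimately have "real N = t / a" by (simp add: N_def)
      then show ?thesis using a by simp
    qed
    \<comment> \<open>As \<open>1 \<le> \<Lambda> a\<close>, the product is at most
      \<open>(\<Lambda> a)\<^sup>2 * a\<close>, which is eventually below 1.\<close>
    have aL: "a * \<Lambda> a \<le> 1"
    proof -
      have "\<Lambda> a * (a * 1) \<le> \<Lambda> a * (a * \<Lambda> a)" using a L by (intro mult_left_mono) auto
      then show ?thesis using La by (simp add: power2_eq_square mult_ac)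
    qed
    have Nsq: "real N * (C * (a * \<Lambda> a)\<^sup>2) = C * (t * ((\<Lambda> a)\<^sup>2 * a))"
      unfolding N[symmetric] by (simp add: power2_eq_square mult_ac)
    have e_eq: "real N * exp (real N * (m * a + C * (a * \<Lambda> a)\<^sup>2)) * (C * (a * \<Lambda> a)\<^sup>2) = e a"
    proof -
      have "real N * (m * a + C * (a * \<Lambda> a)\<^sup>2) = m * t + C * (t * ((\<Lambda> a)\<^sup>2 * a))"
        unfolding distrib_left Nsq using N by (simp add: mult_ac)
      then show ?thesis unfolding e_def Nsq[symmetric] by (simp add: mult_ac)
    qed
    have e0: "0 \<le> e a" unfolding e_def using C a assms(5) by simp
    let ?D = "\<lambda>\<psi> x. op_exp (- \<i> * of_real t) (hamiltonian Q A M) \<psi> x - (walk_step Q A M a ^^ N) \<psi> x"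
    let ?S = "\<lambda>p. matrix_exp (mat (- \<i> * of_real t) ** hamiltonian_symbol Q A M p)
         - ((**) (matrix_exp (mat (- \<i> * of_real a) ** M) ** walk_symbol Q A (a *\<^sub>R p)) ^^ N) (mat 1)"
    have "L2_norm (?D \<psi>) \<le> ennreal (e a)" if \<psi>: "\<psi> \<in> momentum_cutoff (\<Lambda> a)" "L2_norm \<psi> \<le> 1" for \<psi>
    proof -
      obtain \<phi> where r: "represents (\<Lambda> a) \<psi> \<phi>" using \<psi>(1) by (auto simp: momentum_cutoff_iff)
      \<comment> \<open>This bound grows with the cutoff, but it serves the convergence of the
        exponential series and does not enter \<open>e\<close>.\<close>
      let ?B = "(\<Sum>q\<in>Q. norm (mat_endo (A q)) * qsize q) * \<Lambda> a + norm (mat_endo M)"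
      have "multiplier (\<Lambda> a) (op_exp (- \<i> * of_real t) (hamiltonian Q A M))
          (\<lambda>p. matrix_exp (mat (- \<i> * of_real t) ** hamiltonian_symbol Q A M p))"
      proof (rule multiplier_op_exp[OF multiplier_hamiltonian, where B = ?B])
        show "norm (mat_endo (hamiltonian_symbol Q A M p)) \<le> ?B" if "\<And>b. \<bar>p $ b\<bar> \<le> \<Lambda> a" for p
          unfolding hamiltonian_symbol_def mat_endo_add
          by (intro order_trans[OF norm_triangle_ineq] add_right_mono hamiltonian_symbol_bound that)
        show "0 \<le> ?B"
          using L by (intro add_nonneg_nonneg mult_nonneg_nonneg sum_nonneg qsize_nonneg) auto
      qed
      then have "represents (\<Lambda> a) (?D \<psi>) (\<lambda>p. ?S p *v \<phi> p)"
        unfolding matrix_vector_mult_diff_rdistrib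
        by (intro represents_diff multiplierD[OF _ r] multiplier_funpow multiplier_walk_step)
      then have "L2_norm (?D \<psi>) \<le> ennreal (e a) * L2_norm \<phi>"
      proof (rule represents_norm_le)
        show "amplitude (\<Lambda> a) \<phi>" using r by (simp add: represents_def)
        show "norm (mat_endo (?S p)) \<le> e a" if "\<And>b. \<bar>p $ b\<bar> \<le> \<Lambda> a" for p
          using err[rule_format, OF a L aL that, of N] unfolding N e_eq .
      qed (rule e0)
      also have "\<dots> \<le> ennreal (e a) * 1"
        using \<psi>(2) represents_L2_norm[OF r] by (intro mult_left_mono) auto
      finally show ?thesis by simp
    qed
    then have "cutoff_norm (\<Lambda> a) ?D \<le> ennreal (e a)"
      unfolding cutoff_norm_def by (intro SUP_least) auto
    then show ?case using e0 by (simp add: N_def)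
  qed
  show ?thesis
    by (rule tendsto_ennreal_zero_bound[where B = e and C = 1]) (use ev e_lim in \<open>auto elim: eventually_mono\<close>)
qed

end
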